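(* For a unital (real) subalgebra $\mathcal{A}\subseteq M_n(\mathbb{H})$, the following are equivalent: (1) $\mathcal{A}$ is triangularizable. (2) If $A,B\in\mathcal{A}$ are nilpotent then so is $A+B$. (3) If at least one of $A,B\in\mathcal{A}$ is nilpotent then so is $AB$. (4) $\mathrm{Tr}([A,B]^2)\le 0$ for all $A,B\in\mathcal{A}$.
   Context: $\mathbb{H}$ is the division ring of real quaternions and $M_n(\mathbb{H})$ the real algebra of $n\times n$ quaternionic matrices. A unital subalgebra is an $\mathbb{R}$-subalgebra containing $I_n$. A set $\mathcal{S}\subseteq M_n(\mathbb{H})$ is triangularizable if there is $P\in\mathrm{GL}_n(\mathbb{H})$ such that every element of $P\mathcal{S}P^{-1}$ is upper triangular. The quaternionic trace of $A=[a_{ij}]\in M_n(\mathbb{H})$ is $\mathrm{Tr}(A)=\sum_{i=1}^n(a_{ii}+\overline{a_{ii}})=2\,\mathrm{Re}\left(\sum_i a_{ii}\right)\in\mathbb{R}$. $[A,B]=AB-BA$. *)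

theory Defs
  imports Complex_Main "Jordan_Normal_Form.Matrix"
begin

datatype quat = Quat (qRe: real) (qIm1: real) (qIm2: real) (qIm3: real)

lemma quat_eq_iff:
  "p = q \<longleftrightarrow> qRe p = qRe q \<and> qIm1 p = qIm1 q \<and> qIm2 p = qIm2 q \<and> qIm3 p = qIm3 q"
  by (cases p; cases q) auto

definition qcnj :: "quat \<Rightarrow> quat" where
  "qcnj q = Quat (qRe q) (- qIm1 q) (- qIm2 q) (- qIm3 q)"

definition qnorm2 :: "quat \<Rightarrow> real" where
  "qnorm2 q = (qRe q)\<^sup>2 + (qIm1 q)\<^sup>2 + (qIm2 q)\<^sup>2 + (qIm3 q)\<^sup>2"

lemma qcnj_sel [simp]:
  "qRe (qcnj q) = qRe q" "qIm1 (qcnj q) = - qIm1 q"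
  "qIm2 (qcnj q) = - qIm2 q" "qIm3 (qcnj q) = - qIm3 q"
  by (simp_all add: qcnj_def)

instantiation quat :: "{real_algebra_1, division_ring}"
begin

definition zero_quat :: quat where "zero_quat = Quat 0 0 0 0"
definition one_quat :: quat where "one_quat = Quat 1 0 0 0"
definition plus_quat :: "quat \<Rightarrow> quat \<Rightarrow> quat" where
  "p + q = Quat (qRe p + qRe q) (qIm1 p + qIm1 q) (qIm2 p + qIm2 q) (qIm3 p + qIm3 q)"
definition uminus_quat :: "quat \<Rightarrow> quat" where
  "- q = Quat (- qRe q) (- qIm1 q) (- qIm2 q) (- qIm3 q)"
definition minus_quat :: "quat \<Rightarrow> quat \<Rightarrow> quat" where
  "p - q = Quat (qRe p - qRe q) (qIm1 p - qIm1 q) (qIm2 p - qIm2 q) (qIm3 p - qIm3 q)"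
definition times_quat :: "quat \<Rightarrow> quat \<Rightarrow> quat" where
  "p * q = Quat
     (qRe p * qRe q - qIm1 p * qIm1 q - qIm2 p * qIm2 q - qIm3 p * qIm3 q)
     (qRe p * qIm1 q + qIm1 p * qRe q + qIm2 p * qIm3 q - qIm3 p * qIm2 q)
     (qRe p * qIm2 q - qIm1 p * qIm3 q + qIm2 p * qRe q + qIm3 p * qIm1 q)
     (qRe p * qIm3 q + qIm1 p * qIm2 q - qIm2 p * qIm1 q + qIm3 p * qRe q)"
definition scaleR_quat :: "real \<Rightarrow> quat \<Rightarrow> quat" where
  "r *\<^sub>R q = Quat (r * qRe q) (r * qIm1 q) (r * qIm2 q) (r * qIm3 q)"
definition inverse_quat :: "quat \<Rightarrow> quat" where
  "inverse q = inverse (qnorm2 q) *\<^sub>R qcnj q"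
definition divide_quat :: "quat \<Rightarrow> quat \<Rightarrow> quat" where
  "divide p q = p * inverse (q :: quat)"

lemmas quat_ops = zero_quat_def one_quat_def plus_quat_def uminus_quat_def minus_quat_def
  times_quat_def scaleR_quat_def

lemma qnorm2_eq_0_iff: "qnorm2 q = 0 \<longleftrightarrow> q = 0"
  by (cases q)
    (simp add: qnorm2_def zero_quat_def add_nonneg_eq_0_iff)

lemma quat_mult_cnj: "q * qcnj q = qnorm2 q *\<^sub>R 1" "qcnj q * q = qnorm2 q *\<^sub>R 1"
  by (simp_all add: quat_ops qnorm2_def power2_eq_square algebra_simps)

instance
proof
  fix p q r :: quat and a b :: real
  show "p * q * r = p * (q * r)" "(p + q) * r = p * r + q * r" "p * (q + r) = p * q + p * r"
    by (simp_all add: quat_ops algebra_simps)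
  show "a *\<^sub>R p * q = a *\<^sub>R (p * q)" "p * a *\<^sub>R q = a *\<^sub>R (p * q)"
    "a *\<^sub>R (p + q) = a *\<^sub>R p + a *\<^sub>R q" "(a + b) *\<^sub>R p = a *\<^sub>R p + b *\<^sub>R p"
    "a *\<^sub>R b *\<^sub>R p = (a * b) *\<^sub>R p" "1 *\<^sub>R p = p"
    by (simp_all add: quat_ops algebra_simps)
  show "p + q + r = p + (q + r)" "p + q = q + p" "0 + p = p" "- p + p = 0" "p - q = p + - q"
    "1 * p = p" "p * 1 = p" "(0::quat) \<noteq> 1" "inverse (0::quat) = 0"
    by (simp_all add: quat_ops inverse_quat_def qcnj_def)
  show "p div q = p * inverse q"
    by (simp add: divide_quat_def)
  have scale: "p * a *\<^sub>R q = a *\<^sub>R (p * q)" "a *\<^sub>R p * q = a *\<^sub>R (p * q)" for a and p q :: quat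
    by (simp_all add: quat_ops algebra_simps)
  assume "p \<noteq> 0"
  then have "qnorm2 p \<noteq> 0"
    by (simp add: qnorm2_eq_0_iff)
  then have "inverse (qnorm2 p) *\<^sub>R qnorm2 p *\<^sub>R 1 = (1::quat)"
    by (simp add: quat_ops)
  then show "inverse p * p = 1" "p * inverse p = 1"
    by (simp_all add: inverse_quat_def scale quat_mult_cnj)
qed

end

text \<open>Hamilton's relations for the basis \<open>1, i, j, k\<close>.\<close>

lemma quat_hamilton:
  defines "i \<equiv> Quat 0 1 0 0" and "j \<equiv> Quat 0 0 1 0" and "k \<equiv> Quat 0 0 0 1"
  shows "i * i = -1" "j * j = -1" "k * k = -1" "i * j * k = -1"
  by (simp_all add: i_def j_def k_def quat_ops)

lemma of_real_quat: "of_real r = Quat r 0 0 0"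
  by (simp add: of_real_def quat_ops)

text \<open>
  \<open>M\<^sub>n(\<H>)\<close> is \<open>carrier_mat n n\<close>. A real number \<open>r\<close> acts on it by the central scalar \<open>of_real r\<close>,
  so the following is closure under the real algebra operations, not the quaternionic ones.
\<close>

definition unital_real_subalgebra :: "nat \<Rightarrow> quat mat set \<Rightarrow> bool" where
  "unital_real_subalgebra n \<A> \<longleftrightarrow>
     \<A> \<subseteq> carrier_mat n n \<and> 1\<^sub>m n \<in> \<A> \<and>
     (\<forall>A\<in>\<A>. \<forall>B\<in>\<A>. A + B \<in> \<A>) \<and>
     (\<forall>A\<in>\<A>. \<forall>B\<in>\<A>. A * B \<in> \<A>) \<and>
     (\<forall>r::real. \<forall>A\<in>\<A>. of_real r \<cdot>\<^sub>m A \<in> \<A>)"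

text \<open>Here \<open>Q\<close> is \<open>P\<^sup>-\<^sup>1\<close>.\<close>

definition triangularizable :: "nat \<Rightarrow> quat mat set \<Rightarrow> bool" where
  "triangularizable n \<S> \<longleftrightarrow>
     (\<exists>P\<in>carrier_mat n n. \<exists>Q\<in>carrier_mat n n.
        inverts_mat P Q \<and> inverts_mat Q P \<and> (\<forall>A\<in>\<S>. upper_triangular (P * A * Q)))"

definition nilpotent_mat :: "nat \<Rightarrow> quat mat \<Rightarrow> bool" where
  "nilpotent_mat n A \<longleftrightarrow> (\<exists>k. A ^\<^sub>m k = 0\<^sub>m n n)"

text \<open>
  The sum is a real quaternion (see \<open>of_real_qTr\<close>); \<open>qRe\<close> only reads it off as a real number.
\<close>

definition qTr :: "quat mat \<Rightarrow> real" where
  "qTr A = qRe (\<Sum>i<dim_row A. A $$ (i, i) + qcnj (A $$ (i, i)))"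

lemma of_real_qTr: "of_real (qTr A) = (\<Sum>i<dim_row A. A $$ (i, i) + qcnj (A $$ (i, i)))"
proof -
  have "of_real (qRe (\<Sum>i\<in>I. f i + qcnj (f i))) = (\<Sum>i\<in>I. f i + qcnj (f i))"
    if "finite I" for I :: "nat set" and f
    using that by induction (simp_all add: of_real_quat plus_quat_def quat_eq_iff zero_quat_def)
  then show ?thesis
    by (simp add: qTr_def)
qed

definition commutator :: "quat mat \<Rightarrow> quat mat \<Rightarrow> quat mat" where
  "commutator A B = A * B - B * A"

end

theory Submission
  imports Defs "HOL-Computational_Algebra.Fundamental_Theorem_Algebra"
begin

text \<open>
  An algebra that is not triangularizable has an irreducible block of size at least 2 and therefore
  contains a pair \<open>P\<close>, \<open>Q\<close> behaving like the matrix units \<open>E\<^sub>1\<^sub>2\<close>, \<open>E\<^sub>2\<^sub>1\<close>: \<open>P\<^sup>2 = Q\<^sup>2 = 0\<close> and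
  \<open>e = P Q\<close> is a nonzero idempotent. Such a pair violates each condition: \<open>(P + Q)\<^sup>2 e = e\<close>,
  \<open>P Q\<close> is not nilpotent, and \<open>Tr ([P, Q]\<^sup>2) = 2 Tr e > 0\<close>.

  Conversely, suppose that there is no such pair and let the algebra act on \<open>\<H>\<^sup>m\<close>. On a minimal
  invariant right \<open>\<H>\<close>-subspace \<open>W\<close>, idempotents then act as \<open>0\<close> or \<open>1\<close>, hence every element acts as
  zero or invertibly, so the action is by a real division algebra, which the argument of Frobenius
  identifies with the reals, the complex numbers or the quaternions acting in a standard way. This
  yields a vector \<open>v\<close> whose line \<open>v \<H>\<close> is invariant; make it the first basis vector and induct on \<open>m\<close>.
\<close>

section \<open>Right quaternionic vectors and real dimension\<close>

text \<open>One type of vectors serves all dimensions; \<open>qsupp m\<close> later cuts out the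
  vectors of length m.\<close>

datatype qvec = QVec (entry: "nat \<Rightarrow> quat")

lemma qvec_eq_iff: "x = y \<longleftrightarrow> (\<forall>i. entry x i = entry y i)"
  by (cases x; cases y) auto

instantiation qvec :: ab_group_add
begin

definition zero_qvec :: qvec where "0 = QVec (\<lambda>_. 0)"
definition plus_qvec :: "qvec \<Rightarrow> qvec \<Rightarrow> qvec" where "x + y = QVec (\<lambda>i. entry x i + entry y i)"
definition minus_qvec :: "qvec \<Rightarrow> qvec \<Rightarrow> qvec" where "x - y = QVec (\<lambda>i. entry x i - entry y i)"
definition uminus_qvec :: "qvec \<Rightarrow> qvec" where "- x = QVec (\<lambda>i. - entry x i)"

lemma entry_simps [simp]:
  "entry 0 i = 0" "entry (x + y) i = entry x i + entry y i"
  "entry (x - y) i = entry x i - entry y i" "entry (- x) i = - entry x i"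
  by (simp_all add: zero_qvec_def plus_qvec_def minus_qvec_def uminus_qvec_def)

instance
  by standard (simp_all add: qvec_eq_iff)

end

text \<open>Scalars act from the right so that they commute with matrices, which act from the
  left.\<close>

definition rscale :: "qvec \<Rightarrow> quat \<Rightarrow> qvec" (infixl "\<triangleleft>" 75) where
  "x \<triangleleft> q = QVec (\<lambda>i. entry x i * q)"

lemma entry_rscale [simp]: "entry (x \<triangleleft> q) i = entry x i * q"
  by (simp add: rscale_def)

lemma rscale_simps [simp]:
  "(x + y) \<triangleleft> q = x \<triangleleft> q + y \<triangleleft> q" "(x - y) \<triangleleft> q = x \<triangleleft> q - y \<triangleleft> q"
  "(- x) \<triangleleft> q = - (x \<triangleleft> q)" "x \<triangleleft> p \<triangleleft> q = x \<triangleleft> (p * q)" "x \<triangleleft> 1 = x" "0 \<triangleleft> q = 0"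
  "x \<triangleleft> 0 = 0" "x \<triangleleft> - q = - (x \<triangleleft> q)"
  by (simp_all add: qvec_eq_iff distrib_right left_diff_distrib mult.assoc)

lemma rscale_add: "x \<triangleleft> (p + q) = x \<triangleleft> p + x \<triangleleft> q"
  by (simp add: qvec_eq_iff distrib_left)

lemma rscale_diff: "x \<triangleleft> (p - q) = x \<triangleleft> p - x \<triangleleft> q"
  by (simp add: qvec_eq_iff right_diff_distrib)

lemma rscale_eq_0_iff [simp]: "x \<triangleleft> q = 0 \<longleftrightarrow> x = 0 \<or> q = 0"
  by (auto simp: qvec_eq_iff)

section \<open>Real subspaces and the descending chain condition\<close>

definition qsupp :: "nat \<Rightarrow> qvec set" where
  "qsupp m = {x. \<forall>i\<ge>m. entry x i = 0}"

text \<open>Only real scalars are required, because minimal real submodules and one-sided ideals of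
  the algebra need not be closed under \<H>.\<close>

definition rsubspace :: "qvec set \<Rightarrow> bool" where
  "rsubspace S \<longleftrightarrow> 0 \<in> S \<and> (\<forall>x\<in>S. \<forall>y\<in>S. x + y \<in> S) \<and> (\<forall>x\<in>S. \<forall>r. x \<triangleleft> of_real r \<in> S)"

lemma rsubspace_0: "rsubspace S \<Longrightarrow> 0 \<in> S"
  and rsubspace_add: "rsubspace S \<Longrightarrow> x \<in> S \<Longrightarrow> y \<in> S \<Longrightarrow> x + y \<in> S"
  and rsubspace_scale: "rsubspace S \<Longrightarrow> x \<in> S \<Longrightarrow> x \<triangleleft> of_real r \<in> S"
  by (auto simp: rsubspace_def)

lemma rsubspace_diff: "rsubspace S \<Longrightarrow> x \<in> S \<Longrightarrow> y \<in> S \<Longrightarrow> x - y \<in> S"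
  using rsubspace_add[of S x "- y"] rsubspace_scale[of S y "-1"] by simp

text \<open>Each entry contributes four consecutive real coordinates, so vectors in
  \<open>qsupp m\<close> have \<open>4 * m\<close> of them.\<close>

definition qcoord :: "nat \<Rightarrow> qvec \<Rightarrow> real" where
  "qcoord k x = (let q = entry x (k div 4) in
     if k mod 4 = 0 then qRe q else if k mod 4 = 1 then qIm1 q
     else if k mod 4 = 2 then qIm2 q else qIm3 q)"

lemma qcoord_diff: "qcoord k (x - y) = qcoord k x - qcoord k y"
  by (simp add: qcoord_def minus_quat_def Let_def)

lemma qcoord_scale: "qcoord k (x \<triangleleft> of_real r) = qcoord k x * r"
  by (simp add: qcoord_def of_real_quat times_quat_def Let_def)

lemma qcoord_eq_0:
  assumes "x \<in> qsupp m" "\<And>k. k < 4 * m \<Longrightarrow> qcoord k x = 0"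
  shows "x = 0"
proof (unfold qvec_eq_iff, rule allI)
  fix i
  show "entry x i = entry 0 i"
  proof (cases "i < m")
    case True
    then have "qcoord (4 * i) x = 0" "qcoord (4 * i + 1) x = 0" "qcoord (4 * i + 2) x = 0"
      "qcoord (4 * i + 3) x = 0"
      by (auto intro!: assms(2))
    moreover have "(4 * i + 1) mod 4 = 1" "(4 * i + 2) mod 4 = 2" "(4 * i + 3) mod 4 = 3"
      "(4 * i + 1) div 4 = i" "(4 * i + 2) div 4 = i" "(4 * i + 3) div 4 = i"
      by presburger+
    ultimately show ?thesis
      unfolding qcoord_def Let_def by (simp add: quat_eq_iff zero_quat_def del: add_2_eq_Suc' One_nat_def add_Suc_right)
  qed (use assms(1) in \<open>simp add: qsupp_def\<close>)
qed

text \<open>The pivot columns of an echelon basis; for a real subspace of \<open>qsupp m\<close>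
  their number is the real dimension.\<close>

definition pivots :: "nat \<Rightarrow> qvec set \<Rightarrow> nat set" where
  "pivots m S = {k. k < 4 * m \<and> (\<exists>x\<in>S. qcoord k x \<noteq> 0 \<and> (\<forall>j<k. qcoord j x = 0))}"

text \<open>Gaussian elimination: an element of T whose first nonzero coordinate is k is cleared
  there by a multiple of an element of S with the same pivot. The induction runs downward on the
  number k of leading zeros, from \<open>4 * m\<close>, where only 0 is left.\<close>

lemma pivots_eq_imp_subset:
  assumes S: "rsubspace S" and T: "rsubspace T" and sub: "S \<subseteq> T" "T \<subseteq> qsupp m"
    and eq: "pivots m S = pivots m T"
  shows "T \<subseteq> S"
proof -
  have "x \<in> S" if "x \<in> T" "k \<le> 4 * m" "\<forall>j<k. qcoord j x = 0" for x k
    using that(2,1,3)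
  proof (induction k arbitrary: x rule: inc_induct)
    case base
    then have "x = 0"
      using sub(2) by (intro qcoord_eq_0[of x m]) auto
    then show ?case
      using S rsubspace_0 by blast
  next
    case (step k)
    show ?case
    proof (cases "qcoord k x = 0")
      case True
      then show ?thesis
        using step by (auto simp: less_Suc_eq)
    next
      case False
      then have "k \<in> pivots m S"
        using step eq by (auto simp: pivots_def)
      then obtain y where y: "y \<in> S" "qcoord k y \<noteq> 0" "\<forall>j<k. qcoord j y = 0"
        by (auto simp: pivots_def)
      define c where "c = qcoord k x / qcoord k y"
      have yc: "y \<triangleleft> of_real c \<in> S"
        using S y rsubspace_scale by blast
      have "x - y \<triangleleft> of_real c \<in> S"
        using step y yc sub(1) T
        by (intro step.IH) (auto simp: less_Suc_eq qcoord_diff qcoord_scale c_def intro!: rsubspace_diff)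
      from rsubspace_add[OF S this yc] show ?thesis
        by simp
    qed
  qed
  from this[of _ 0] show ?thesis
    by auto
qed

text \<open>A member with the fewest pivots is minimal, since a subspace of it with no fewer pivots
  equals it. This stands in for finite real dimension in what follows.\<close>

lemma rsubspace_minimal:
  assumes "\<C> \<noteq> {}" and "\<And>S. S \<in> \<C> \<Longrightarrow> rsubspace S \<and> S \<subseteq> qsupp m"
  shows "\<exists>S\<in>\<C>. \<forall>T\<in>\<C>. T \<subseteq> S \<longrightarrow> T = S"
proof -
  obtain S where S: "S \<in> \<C>" "\<And>T. T \<in> \<C> \<Longrightarrow> card (pivots m S) \<le> card (pivots m T)"
    using assms(1) ex_has_least_nat[of "\<lambda>S. S \<in> \<C>" _ "\<lambda>S. card (pivots m S)"] by blast
  have "T = S" if T: "T \<in> \<C>" "T \<subseteq> S" for T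
  proof -
    have "pivots m T \<subseteq> pivots m S"
      using T by (auto simp: pivots_def)
    moreover have "finite (pivots m S)"
      by (simp add: pivots_def)
    ultimately have "pivots m T = pivots m S"
      using S(2)[OF T(1)] by (simp add: card_seteq)
    then show ?thesis
      using pivots_eq_imp_subset[of T S m] assms(2) S T by blast
  qed
  then show ?thesis
    using S(1) by blast
qed

section \<open>Descending chains of real spaces of matrices\<close>

lemma mod_less_of_less_mult: "k < n * n \<Longrightarrow> k mod n < (n::nat)"
  by (cases "n = 0") auto

text \<open>Row-by-row flattening, which carries the chain condition from
  \<open>qsupp (n * n)\<close> over to matrices.\<close>

definition mat_vec :: "nat \<Rightarrow> quat mat \<Rightarrow> qvec" where
  "mat_vec n X = QVec (\<lambda>k. if k < n * n then X $$ (k div n, k mod n) else 0)"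

lemma mat_vec_inj: "inj_on (mat_vec n) (carrier_mat n n)"
proof (rule inj_onI)
  fix X Y assume XY: "X \<in> carrier_mat n n" "Y \<in> carrier_mat n n" "mat_vec n X = mat_vec n Y"
  show "X = Y"
  proof (rule eq_matI)
    fix i j assume "i < dim_row Y" "j < dim_col Y"
    then have ij: "i < n" "j < n"
      using XY by auto
    then have "i * n + j < n * n"
      by (metis div_less_iff_less_mult div_mult_self3 gr_zeroI less_nat_zero_code div_less add_0_right)
    moreover have "(i * n + j) div n = i" "(i * n + j) mod n = j"
      using ij by auto
    ultimately show "X $$ (i, j) = Y $$ (i, j)"
      using arg_cong[OF XY(3), of "\<lambda>x. entry x (i * n + j)"] by (simp add: mat_vec_def)
  qed (use XY in auto)
qed

lemma mat_vec_add:
  assumes "X \<in> carrier_mat n n" "Y \<in> carrier_mat n n"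
  shows "mat_vec n (X + Y) = mat_vec n X + mat_vec n Y"
  using assms by (auto simp: mat_vec_def qvec_eq_iff less_mult_imp_div_less mod_less_of_less_mult)

lemma of_real_quat_commute: "of_real r * q = q * (of_real r :: quat)"
  by (simp add: of_real_quat times_quat_def mult.commute)

lemma mat_vec_scale:
  assumes "X \<in> carrier_mat n n"
  shows "mat_vec n (of_real r \<cdot>\<^sub>m X) = mat_vec n X \<triangleleft> of_real r"
  using assms by (auto simp: mat_vec_def qvec_eq_iff less_mult_imp_div_less mod_less_of_less_mult
      of_real_quat_commute)

definition rsubspace_mat :: "nat \<Rightarrow> quat mat set \<Rightarrow> bool" where
  "rsubspace_mat n S \<longleftrightarrow> S \<subseteq> carrier_mat n n \<and> 0\<^sub>m n n \<in> S \<and>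
     (\<forall>X\<in>S. \<forall>Y\<in>S. X + Y \<in> S) \<and> (\<forall>X\<in>S. \<forall>r. of_real r \<cdot>\<^sub>m X \<in> S)"

lemma rsubspace_mat_minimal:
  assumes "\<C> \<noteq> {}" and \<C>: "\<And>S. S \<in> \<C> \<Longrightarrow> rsubspace_mat n S"
  shows "\<exists>S\<in>\<C>. \<forall>T\<in>\<C>. T \<subseteq> S \<longrightarrow> T = S"
proof -
  have "rsubspace (mat_vec n ` S) \<and> mat_vec n ` S \<subseteq> qsupp (n * n)" if "S \<in> \<C>" for S
  proof -
    note S = \<C>[OF that, unfolded rsubspace_mat_def]
    have "mat_vec n (0\<^sub>m n n) = 0"
      by (auto simp: mat_vec_def qvec_eq_iff less_mult_imp_div_less mod_less_of_less_mult)
    then have "0 \<in> mat_vec n ` S"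
      using S by (metis imageI)
    moreover have "mat_vec n X + mat_vec n Y \<in> mat_vec n ` S" if "X \<in> S" "Y \<in> S" for X Y
      using mat_vec_add[of X n Y] S that by (metis imageI subsetD)
    moreover have "mat_vec n X \<triangleleft> of_real r \<in> mat_vec n ` S" if "X \<in> S" for X r
      using mat_vec_scale[of X n r] S that by (metis imageI subsetD)
    ultimately show ?thesis
      by (auto simp: rsubspace_def qsupp_def mat_vec_def)
  qed
  then have "\<exists>S\<in>(`) (mat_vec n) ` \<C>. \<forall>T\<in>(`) (mat_vec n) ` \<C>. T \<subseteq> S \<longrightarrow> T = S"
    using assms(1) by (intro rsubspace_minimal[of _ "n * n"]) auto
  then obtain S where S: "S \<in> \<C>" "\<And>T. T \<in> \<C> \<Longrightarrow> mat_vec n ` T \<subseteq> mat_vec n ` S \<Longrightarrow> mat_vec n ` T = mat_vec n ` S"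
    by auto
  have "T = S" if "T \<in> \<C>" "T \<subseteq> S" for T
    using S that \<C> inj_on_image_eq_iff[OF mat_vec_inj, of T n S]
    by (auto simp: rsubspace_mat_def image_mono)
  then show ?thesis
    using S(1) by blast
qed

section \<open>Idempotents in real matrix algebras\<close>

text \<open>The conditions on sums, products and traces each imply this property, and it implies
  triangularizability.\<close>

definition no_nilpotent_pair :: "nat \<Rightarrow> quat mat set \<Rightarrow> bool" where
  "no_nilpotent_pair n A \<longleftrightarrow> (\<forall>P\<in>A. \<forall>Q\<in>A. P * P = 0\<^sub>m n n \<longrightarrow> Q * Q = 0\<^sub>m n n \<longrightarrow>
     P * Q * (P * Q) = P * Q \<longrightarrow> P * Q = 0\<^sub>m n n)"

lemma of_real_smult_mult_mat:
  fixes X Y :: "quat mat"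
  assumes "X \<in> carrier_mat n n" "Y \<in> carrier_mat n n"
  shows "X * (of_real r \<cdot>\<^sub>m Y) = of_real r \<cdot>\<^sub>m (X * Y)"
    "(of_real r \<cdot>\<^sub>m X) * Y = of_real r \<cdot>\<^sub>m (X * Y)"
proof -
  have *: "p * (of_real r * q) = of_real r * (p * q)" for p q :: quat
    by (metis mult.assoc of_real_quat_commute)
  show "X * (of_real r \<cdot>\<^sub>m Y) = of_real r \<cdot>\<^sub>m (X * Y)"
    "(of_real r \<cdot>\<^sub>m X) * Y = of_real r \<cdot>\<^sub>m (X * Y)"
    using assms by (auto intro!: eq_matI simp: scalar_prod_def sum_distrib_left mult.assoc *)
qed

section \<open>Arithmetic in a real matrix algebra\<close>

locale real_mat_algebra =
  fixes n :: nat and A :: "quat mat set"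
  assumes alg: "unital_real_subalgebra n A"
begin

lemma carr [simp]: "a \<in> A \<Longrightarrow> a \<in> carrier_mat n n"
  and one_mem [simp]: "1\<^sub>m n \<in> A"
  and add_mem [simp]: "a \<in> A \<Longrightarrow> b \<in> A \<Longrightarrow> a + b \<in> A"
  and mult_mem [simp]: "a \<in> A \<Longrightarrow> b \<in> A \<Longrightarrow> a * b \<in> A"
  and smult_mem [simp]: "a \<in> A \<Longrightarrow> of_real r \<cdot>\<^sub>m a \<in> A"
  using alg by (auto simp: unital_real_subalgebra_def)

lemma dims [simp]: "a \<in> A \<Longrightarrow> dim_row a = n" "a \<in> A \<Longrightarrow> dim_col a = n"
  using carr by blast+

lemma minus_eq: "a \<in> A \<Longrightarrow> b \<in> A \<Longrightarrow> a - b = a + of_real (- 1) \<cdot>\<^sub>m b"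
  by (intro eq_matI) auto

lemma zero_eq: "a \<in> A \<Longrightarrow> 0\<^sub>m n n = of_real 0 \<cdot>\<^sub>m a"
  by (intro eq_matI) auto

lemma minus_mem [simp]: "a \<in> A \<Longrightarrow> b \<in> A \<Longrightarrow> a - b \<in> A"
  by (simp add: minus_eq del: of_real_minus of_real_1)

lemma zero_mem [simp]: "0\<^sub>m n n \<in> A"
  using smult_mem[OF one_mem] zero_eq[OF one_mem] by metis

lemma pow_mem [simp]: "a \<in> A \<Longrightarrow> a ^\<^sub>m k \<in> A"
  by (induction k) simp_all

text \<open>Membership in A replaces the dimension side conditions of the matrix laws, so the
  simplifier computes in A as in a ring, with products nested to the right.\<close>

lemma alg_simps [simp]:
  assumes "a \<in> A" "b \<in> A" "c \<in> A"
  shows "a * b * c = a * (b * c)" "(a + b) * c = a * c + b * c" "a * (b + c) = a * b + a * c"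
    "(a - b) * c = a * c - b * c" "a * (b - c) = a * b - a * c"
  using assms[THEN carr] by (fact assoc_mult_mat add_mult_distrib_mat mult_add_distrib_mat
      minus_mult_distrib_mat mult_minus_distrib_mat)+

lemma unit_simps [simp]:
  assumes "a \<in> A"
  shows "a * 0\<^sub>m n n = 0\<^sub>m n n" "0\<^sub>m n n * a = 0\<^sub>m n n" "a * 1\<^sub>m n = a" "1\<^sub>m n * a = a"
    "a + 0\<^sub>m n n = a" "0\<^sub>m n n + a = a" "a - 0\<^sub>m n n = a" "a - a = 0\<^sub>m n n"
  using carr[OF assms] by (auto intro!: eq_matI)

lemma pow_add: "a \<in> A \<Longrightarrow> a ^\<^sub>m (i + j) = a ^\<^sub>m i * a ^\<^sub>m j"
  by (induction j) simp_all

text \<open>Fitting's lemma: the chains \<open>A z\<^sup>k\<close> and \<open>z\<^sup>k A\<close> both become stationary.\<close>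

lemma strongly_regular_power:
  assumes z: "z \<in> A"
  shows "\<exists>k a c. a \<in> A \<and> c \<in> A \<and> z ^\<^sub>m Suc k = a * (z ^\<^sub>m Suc k * z ^\<^sub>m Suc k) \<and>
    z ^\<^sub>m Suc k = z ^\<^sub>m Suc k * z ^\<^sub>m Suc k * c"
proof -
  define L where "L k = (\<lambda>a. a * z ^\<^sub>m k) ` A" for k
  define R where "R k = (\<lambda>a. z ^\<^sub>m k * a) ` A" for k
  have "rsubspace_mat n (L k)" for k
    unfolding rsubspace_mat_def L_def
  proof (safe, goal_cases)
    case 2
    show ?case
      using z by (intro image_eqI[of _ _ "0\<^sub>m n n"]) simp_all
  next
    case (3 _ a _ b)
    then show ?case
      using z by (intro image_eqI[of _ _ "a + b"]) simp_all
  next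
    case (4 _ a r)
    then show ?case
      using z by (intro image_eqI[of _ _ "of_real r \<cdot>\<^sub>m a"]) (simp_all add: of_real_smult_mult_mat[of _ n])
  qed (use z in simp)
  \<comment> \<open>Exponents start at 1 because the conclusion needs a positive power of z.\<close>
  then have "\<exists>S\<in>L ` {1..}. \<forall>T\<in>L ` {1..}. T \<subseteq> S \<longrightarrow> T = S"
    by (intro rsubspace_mat_minimal[of _ n]) auto
  then obtain k where k: "\<And>j. 1 \<le> j \<Longrightarrow> L j \<subseteq> L k \<Longrightarrow> L j = L k" "1 \<le> k"
    by auto
  have Lk: "L j = L k" if "k \<le> j" for j
  proof (rule k)
    show "L j \<subseteq> L k"
    proof (unfold L_def, safe)
      fix a assume "a \<in> A"
      then show "a * z ^\<^sub>m j \<in> (\<lambda>a. a * z ^\<^sub>m k) ` A"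
        using pow_add[OF z, of "j - k" k] that z
        by (intro image_eqI[of _ _ "a * z ^\<^sub>m (j - k)"]) simp_all
    qed
  qed (use that k in simp)
  have "rsubspace_mat n (R k)" for k
    unfolding rsubspace_mat_def R_def
  proof (safe, goal_cases)
    case 2
    show ?case
      using z by (intro image_eqI[of _ _ "0\<^sub>m n n"]) simp_all
  next
    case (3 _ a _ b)
    then show ?case
      using z by (intro image_eqI[of _ _ "a + b"]) simp_all
  next
    case (4 _ a r)
    then show ?case
      using z by (intro image_eqI[of _ _ "of_real r \<cdot>\<^sub>m a"]) (simp_all add: of_real_smult_mult_mat[of _ n])
  qed (use z in simp)
  \<comment> \<open>This chain starts at k, so from its stationary index l on both chains are
    constant.\<close>
  then have "\<exists>S\<in>R ` {k..}. \<forall>T\<in>R ` {k..}. T \<subseteq> S \<longrightarrow> T = S"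
    by (intro rsubspace_mat_minimal[of _ n]) auto
  then obtain l where l: "\<And>j. k \<le> j \<Longrightarrow> R j \<subseteq> R l \<Longrightarrow> R j = R l" "k \<le> l"
    by auto
  have Rl: "R j = R l" if "l \<le> j" for j
  proof (rule l)
    show "R j \<subseteq> R l"
    proof (unfold R_def, safe)
      fix a assume "a \<in> A"
      then show "z ^\<^sub>m j * a \<in> (\<lambda>a. z ^\<^sub>m l * a) ` A"
        using pow_add[OF z, of l "j - l"] that z
        by (intro image_eqI[of _ _ "z ^\<^sub>m (j - l) * a"]) simp_all
    qed
  qed (use that l in simp)
  define w where "w = z ^\<^sub>m l"
  have ww: "z ^\<^sub>m (l + l) = w * w" and w: "w \<in> A"
    using z by (simp_all add: pow_add w_def)
  have "w \<in> L l" "w \<in> R l"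
    using z by (auto simp: L_def R_def w_def intro!: image_eqI[of _ _ "1\<^sub>m n"])
  \<comment> \<open>Membership at exponent \<open>l + l\<close> makes w both a left and a right
    multiple of \<open>w * w\<close>.\<close>
  then have "w \<in> L (l + l)" "w \<in> R (l + l)"
    using Lk[of l] Lk[of "l + l"] Rl[of "l + l"] l by auto
  then obtain a c where "a \<in> A" "c \<in> A" "w = a * (w * w)" "w = w * w * c"
    unfolding L_def R_def ww by blast
  moreover have "l = Suc (l - 1)"
    using k l by simp
  ultimately show ?thesis
    unfolding w_def by metis
qed

end

section \<open>Representations, invariant subspaces and idempotents\<close>

locale mat_rep = real_mat_algebra +
  fixes m :: nat and \<rho> :: "quat mat \<Rightarrow> qvec \<Rightarrow> qvec"
  assumes \<rho>_add: "a \<in> A \<Longrightarrow> \<rho> a (x + y) = \<rho> a x + \<rho> a y"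
    and \<rho>_scale: "a \<in> A \<Longrightarrow> \<rho> a (x \<triangleleft> q) = \<rho> a x \<triangleleft> q"
    and \<rho>_plus: "a \<in> A \<Longrightarrow> b \<in> A \<Longrightarrow> \<rho> (a + b) x = \<rho> a x + \<rho> b x"
    and \<rho>_mult: "a \<in> A \<Longrightarrow> b \<in> A \<Longrightarrow> \<rho> (a * b) x = \<rho> a (\<rho> b x)"
    and \<rho>_smult: "a \<in> A \<Longrightarrow> \<rho> (of_real r \<cdot>\<^sub>m a) x = \<rho> a x \<triangleleft> of_real r"
    and \<rho>_one: "x \<in> qsupp m \<Longrightarrow> \<rho> (1\<^sub>m n) x = x"
    and \<rho>_supp: "a \<in> A \<Longrightarrow> x \<in> qsupp m \<Longrightarrow> \<rho> a x \<in> qsupp m"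
begin

lemma \<rho>_uminus: "a \<in> A \<Longrightarrow> \<rho> a (- x) = - \<rho> a x"
  using \<rho>_scale[of a x "-1"] by simp

lemma \<rho>_diff: "a \<in> A \<Longrightarrow> \<rho> a (x - y) = \<rho> a x - \<rho> a y"
  using \<rho>_add[of a x "- y"] \<rho>_uminus[of a y] by simp

lemma \<rho>_0: "a \<in> A \<Longrightarrow> \<rho> a 0 = 0"
  using \<rho>_scale[of a 0 0] by simp

lemma \<rho>_minus: "a \<in> A \<Longrightarrow> b \<in> A \<Longrightarrow> \<rho> (a - b) x = \<rho> a x - \<rho> b x"
  using \<rho>_plus[of a "of_real (-1) \<cdot>\<^sub>m b" x] \<rho>_smult[of b "-1" x]
  by (simp add: minus_eq del: of_real_minus of_real_1) simp

lemma \<rho>_zero: "\<rho> (0\<^sub>m n n) x = 0"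
  by (metis \<rho>_smult one_mem zero_eq of_real_0 rscale_simps(7))

lemmas \<rho>_simps = \<rho>_add \<rho>_scale \<rho>_plus \<rho>_mult \<rho>_smult \<rho>_uminus \<rho>_diff \<rho>_0 \<rho>_minus \<rho>_zero

text \<open>Real submodules and \<H>-submodules are kept apart: irreducibility concerns the latter,
  while fixed vectors are found in minimal ones of the former kind.\<close>

definition invariant :: "qvec set \<Rightarrow> bool" where
  "invariant W \<longleftrightarrow> rsubspace W \<and> W \<subseteq> qsupp m \<and> (\<forall>a\<in>A. \<forall>x\<in>W. \<rho> a x \<in> W)"

definition qinvariant :: "qvec set \<Rightarrow> bool" where
  "qinvariant W \<longleftrightarrow> invariant W \<and> (\<forall>x\<in>W. \<forall>q. x \<triangleleft> q \<in> W)"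

lemma qinvariantI:
  assumes "W \<subseteq> qsupp m" "0 \<in> W" "\<And>x y. x \<in> W \<Longrightarrow> y \<in> W \<Longrightarrow> x + y \<in> W"
    "\<And>x q. x \<in> W \<Longrightarrow> x \<triangleleft> q \<in> W" "\<And>a x. a \<in> A \<Longrightarrow> x \<in> W \<Longrightarrow> \<rho> a x \<in> W"
  shows "qinvariant W"
  using assms by (auto simp: qinvariant_def invariant_def rsubspace_def)

lemma pow_fixed:
  assumes "z \<in> A" "\<rho> z x = x" "x \<in> qsupp m"
  shows "\<rho> (z ^\<^sub>m k) x = x"
  by (induction k) (use assms in \<open>simp_all add: \<rho>_one \<rho>_mult\<close>)

text \<open>Fitting's lemma gives a power w of z with \<open>w = a * (w * w)\<close> and
  \<open>w = w * w * c\<close>. Then \<open>a * w = w * c\<close> is the idempotent, and it fixes x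
  because w does. Both factorizations through z are used later.\<close>

lemma idempotent_of_fixed:
  assumes z: "z \<in> A" "\<rho> z x = x" and x: "x \<in> qsupp m"
  shows "\<exists>e a c. e \<in> A \<and> a \<in> A \<and> c \<in> A \<and> e = a * z \<and> e = z * c \<and> e * e = e \<and> \<rho> e x = x"
proof -
  obtain k a c where ac: "a \<in> A" "c \<in> A" and
    w: "z ^\<^sub>m Suc k = a * (z ^\<^sub>m Suc k * z ^\<^sub>m Suc k)" "z ^\<^sub>m Suc k = z ^\<^sub>m Suc k * z ^\<^sub>m Suc k * c"
    using strongly_regular_power[OF z(1)] by blast
  define w where "w = z ^\<^sub>m Suc k"
  have wA: "w \<in> A" and aw: "a * (w * w) = w" and wc: "w * (w * c) = w"
    using z(1) ac w unfolding w_def by (metis pow_mem, metis, metis alg_simps(1) pow_mem)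
  \<comment> \<open>Both sides equal \<open>a * (w * (w * c))\<close>.\<close>
  have e: "a * w = w * c"
    using arg_cong[OF wc, of "\<lambda>t. a * t"] arg_cong[OF aw, of "\<lambda>t. t * c"] ac wA by simp
  have "a * w * (a * w) = a * w"
  proof -
    have "a * w * (a * w) = a * w * (w * c)"
      using e by simp
    also have "\<dots> = a * (w * (w * c))"
      using ac wA by simp
    finally show ?thesis
      using wc by simp
  qed
  moreover have "\<rho> (a * w) x = x"
  proof -
    have "\<rho> w x = x"
      using pow_fixed[OF z x] w_def by metis
    then show ?thesis
      using arg_cong[OF aw, of "\<lambda>t. \<rho> t x"] ac wA by (simp add: \<rho>_mult)
  qed
  moreover have "a * w = (a * z ^\<^sub>m k) * z"
    using z ac by (simp add: w_def)
  moreover have "a * w = z * (z ^\<^sub>m k * c)"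
  proof -
    have "w = z * z ^\<^sub>m k"
      using z(1) pow_add[OF z(1), of 1 k] by (simp add: w_def)
    then show ?thesis
      using z(1) ac unfolding e by simp
  qed
  ultimately show ?thesis
    using ac z(1) wA by (metis mult_mem pow_mem)
qed

lemma minimal_qinvariant_exists:
  assumes "0 < m"
  shows "\<exists>W. qinvariant W \<and> W \<noteq> {0} \<and> (\<forall>K. qinvariant K \<longrightarrow> K \<subseteq> W \<longrightarrow> K = {0} \<or> K = W)"
proof -
  have "qinvariant (qsupp m)"
    by (rule qinvariantI) (auto simp: \<rho>_supp, auto simp: qsupp_def)
  moreover have "QVec (\<lambda>i. if i = 0 then 1 else 0) \<in> qsupp m" "QVec (\<lambda>i. if i = 0 then 1 else 0) \<noteq> 0"
    using assms by (auto simp: qsupp_def qvec_eq_iff)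
  ultimately have "\<exists>W\<in>{W. qinvariant W \<and> W \<noteq> {0}}. \<forall>K\<in>{W. qinvariant W \<and> W \<noteq> {0}}. K \<subseteq> W \<longrightarrow> K = W"
    by (intro rsubspace_minimal[of _ m]) (auto simp: qinvariant_def invariant_def)
  then show ?thesis
    by blast
qed

end

section \<open>Irreducible representations: every element acts as zero or invertibly\<close>

locale irreducible_rep = mat_rep +
  fixes W :: "qvec set"
  assumes W: "qinvariant W" "W \<noteq> {0}"
    and W_min: "qinvariant K \<Longrightarrow> K \<subseteq> W \<Longrightarrow> K = {0} \<or> K = W"
    and no_pair: "no_nilpotent_pair n A"
begin

lemma W_supp [simp]: "x \<in> W \<Longrightarrow> x \<in> qsupp m"
  and W_0 [simp]: "0 \<in> W"
  and W_add [simp]: "x \<in> W \<Longrightarrow> y \<in> W \<Longrightarrow> x + y \<in> W"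
  and W_scale [simp]: "x \<in> W \<Longrightarrow> x \<triangleleft> q \<in> W"
  and W_\<rho> [simp]: "a \<in> A \<Longrightarrow> x \<in> W \<Longrightarrow> \<rho> a x \<in> W"
  using W by (auto simp: qinvariant_def invariant_def rsubspace_def)

lemma W_uminus [simp]: "x \<in> W \<Longrightarrow> - x \<in> W"
  using W_scale[of x "-1"] by simp

lemma W_diff [simp]: "x \<in> W \<Longrightarrow> y \<in> W \<Longrightarrow> x - y \<in> W"
  using W_add[of x "- y"] by simp

lemma W_nontrivial: "\<exists>x\<in>W. x \<noteq> 0"
  using W(2) W_0 by blast

text \<open>The vector is found in a minimal real \<open>A\<close>-submodule of \<open>W\<close>, which need not be closed under \<open>\<H>\<close>.\<close>

lemma fixed_vector:
  assumes y: "y \<in> A" and w: "w \<in> W" "\<rho> y w \<noteq> 0"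
  shows "\<exists>b\<in>A. \<exists>x\<in>W. x \<noteq> 0 \<and> \<rho> (b * y) x = x"
proof -
  define \<L> where "\<L> = {L. invariant L \<and> L \<subseteq> W \<and> L \<noteq> {0}}"
  have "\<exists>L\<in>\<L>. \<forall>K\<in>\<L>. K \<subseteq> L \<longrightarrow> K = L"
    by (rule rsubspace_minimal[of _ m]) (use W in \<open>auto simp: \<L>_def qinvariant_def invariant_def\<close>)
  then obtain L where "L \<in> \<L>" and min: "\<forall>K\<in>\<L>. K \<subseteq> L \<longrightarrow> K = L"
    by (rule bexE)
  then have L: "invariant L" "L \<subseteq> W" "L \<noteq> {0}"
    by (simp_all add: \<L>_def)
  have L_min: "K = L" if "invariant K" "K \<subseteq> L" "K \<noteq> {0}" for K
    using that L(2) min[rule_format, of K] by (auto simp: \<L>_def)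
  have "\<exists>x\<in>L. \<rho> y x \<noteq> 0"
  proof (rule ccontr)
    assume yL: "\<not> ?thesis"
    \<comment> \<open>The largest A-invariant subspace of W killed by y. It is closed under \<H>,
      which L need not be, so irreducibility applies to it.\<close>
    define K where "K = {v\<in>W. \<forall>a\<in>A. \<rho> (y * a) v = 0}"
    have "qinvariant K"
    proof (rule qinvariantI)
      fix a v assume a: "a \<in> A" and v: "v \<in> K"
      have "\<rho> (y * b) (\<rho> a v) = 0" if b: "b \<in> A" for b
      proof -
        have "\<rho> (y * (b * a)) v = 0"
          using v a b by (simp add: K_def)
        then show ?thesis
          using a b y by (simp add: \<rho>_mult)
      qed
      then show "\<rho> a v \<in> K"
        using a v by (simp add: K_def)
    qed (use y in \<open>auto simp: K_def \<rho>_simps\<close>)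
    moreover have "L \<subseteq> K"
      using L yL y by (auto simp: K_def \<rho>_mult invariant_def)
    moreover have "0 \<in> L"
      using L by (simp add: invariant_def rsubspace_def)
    ultimately have "K = W"
      using W_min[of K] L(3) by (auto simp: K_def)
    then have "\<rho> (y * 1\<^sub>m n) w = 0"
      using w(1) one_mem unfolding K_def by blast
    then show False
      using w y by simp
  qed
  then obtain x where x: "x \<in> L" "\<rho> y x \<noteq> 0"
    by blast
  \<comment> \<open>The real submodule generated by \<open>\<rho> y x\<close> is nonzero and lies in
    L, so by minimality it contains x; this yields b.\<close>
  define M where "M = (\<lambda>a. \<rho> a (\<rho> y x)) ` A"
  have yx: "\<rho> y x \<in> L"
    using L x y by (simp add: invariant_def)
  have "\<rho> y x \<in> M"
    unfolding M_def using L x y yx \<rho>_one[of "\<rho> y x"]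
    by (intro image_eqI[of _ _ "1\<^sub>m n"]) (auto simp: invariant_def)
  moreover have "M \<subseteq> L"
    using L yx by (auto simp: M_def invariant_def)
  moreover have "rsubspace M"
    unfolding rsubspace_def M_def
  proof (safe, goal_cases)
    case 1
    show ?case
      by (rule image_eqI[of _ _ "0\<^sub>m n n"]) (simp_all add: \<rho>_zero)
  next
    case (2 _ a _ b)
    then show ?case
      by (intro image_eqI[of _ _ "a + b"]) (simp_all add: \<rho>_plus)
  next
    case (3 _ a r)
    then show ?case
      by (intro image_eqI[of _ _ "of_real r \<cdot>\<^sub>m a"]) (simp_all add: \<rho>_smult)
  qed
  moreover have "\<rho> a v \<in> M" if a: "a \<in> A" and v: "v \<in> M" for a v
  proof -
    obtain b where "b \<in> A" "v = \<rho> b (\<rho> y x)"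
      using v by (auto simp: M_def)
    then show ?thesis
      using a unfolding M_def by (intro image_eqI[of _ _ "a * b"]) (simp_all add: \<rho>_mult)
  qed
  ultimately have "M = L"
    using L x(2) by (intro L_min) (auto simp: invariant_def)
  with x(1) have "x \<in> M"
    by simp
  then obtain b where "b \<in> A" "\<rho> b (\<rho> y x) = x"
    unfolding M_def by (metis imageE)
  moreover have "x \<noteq> 0"
    using x(2) y \<rho>_0 by auto
  ultimately show ?thesis
    using x(1) L(2) y by (intro bexI[of _ b] bexI[of _ x]) (auto simp: \<rho>_mult)
qed

text \<open>If y did not vanish on W, there would be an idempotent \<open>e = w * y\<close> fixing
  some nonzero x. The off-diagonal corners of w and y with respect to e square to zero, and their
  product acts on W as e, which leads to a forbidden pair.\<close>

lemma square_zero_imp_zero: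
  assumes y: "y \<in> A" and yy: "\<And>w. w \<in> W \<Longrightarrow> \<rho> y (\<rho> y w) = 0" and v: "v \<in> W"
  shows "\<rho> y v = 0"
proof (rule ccontr)
  assume "\<rho> y v \<noteq> 0"
  then obtain b x where b: "b \<in> A" and x: "x \<in> W" "x \<noteq> 0" "\<rho> (b * y) x = x"
    using fixed_vector y v by blast
  then obtain e a where a: "a \<in> A" "e \<in> A" "e = a * (b * y)" and ee: "e * e = e" and ex: "\<rho> e x = x"
    using idempotent_of_fixed[OF mult_mem[OF b y] x(3) W_supp[OF x(1)]] by blast
  define w where "w = a * b"
  have w: "w \<in> A" and e: "e = w * y"
    using a b y by (simp_all add: w_def)
  have wy: "w * y = e" "w * (y * t) = e * t" "e * (e * t) = e * t" if "t \<in> A" for t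
    using e w y that ee a alg_simps(1)[of w y t] alg_simps(1)[of e e t] by simp_all
  text \<open>
    With \<open>P = e w (1 - e)\<close> and \<open>Q = (1 - e) y e\<close> the product \<open>P Q\<close> agrees with \<open>e\<close> only on \<open>W\<close>;
    it still fixes \<open>x\<close>, so multiplying \<open>P\<close> by a suitable \<open>e a'\<close> turns it into an idempotent of \<open>A\<close>.
  \<close>
  define P where "P = e * w - e * w * e"
  define Q where "Q = y * e - e * y * e"
  define u where "u = P * Q"
  have mem: "P \<in> A" "Q \<in> A" "u \<in> A"
    using a w y by (simp_all add: P_def Q_def u_def)
  \<comment> \<open>Replacing the first e of \<open>e * (y * e)\<close> by \<open>w * y\<close>
    exposes a factor \<open>y * y\<close>, which is zero on W.\<close>
  have u: "u = e - e * (w * (w * (y * (y * e))))"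
  proof -
    have "u = e * (w * (y * e)) - e * (w * (e * (y * e)))"
      using a(2) w y ee wy(3) by (simp add: u_def P_def Q_def)
    also have "e * (y * e) = w * (y * (y * e))"
      using a(2) w y by (subst e) simp
    also have "w * (y * e) = e"
      using wy(2)[OF a(2)] ee by simp
    finally show ?thesis
      using ee by simp
  qed
  have "\<rho> u x = x"
    using a(2) w y x(1) ex yy by (simp add: u \<rho>_simps)
  then obtain e' a' c where e': "e' \<in> A" "a' \<in> A" "c \<in> A" "e' = a' * u" "e' = u * c" "e' * e' = e'"
    and e'x: "\<rho> e' x = x"
    using idempotent_of_fixed[OF mem(3) _ W_supp[OF x(1)]] by blast
  have eu: "e * u = u"
    using a(2) w y ee wy(3) by (simp add: u)
  define P' where "P' = e * a' * P"
  \<comment> \<open>The form \<open>e' = a' * u\<close> turns the product into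
    \<open>e * e'\<close>; the form \<open>e' = u * c\<close> together with \<open>e * u = u\<close>
    shows that this is e'.\<close>
  have PQ: "P' * Q = e'"
  proof -
    have "P' * Q = e * (a' * u)"
      using a(2) mem e'(1-3) by (simp add: P'_def u_def)
    also have "\<dots> = e * u * c"
      using a(2) mem(3) e'(1-3,5) e'(4)[symmetric] by simp
    finally show ?thesis
      using eu e'(5) by simp
  qed
  have Pe: "P * (e * t) = 0\<^sub>m n n" if "t \<in> A" for t
    using a(2) w ee that wy(3) by (simp add: P_def)
  have "P' * P' = 0\<^sub>m n n"
    using a(2) mem(1) e'(2) Pe by (simp add: P'_def)
  moreover have "Q * Q = 0\<^sub>m n n"
    using a(2) y ee wy(3) by (simp add: Q_def)
  ultimately have "P' * Q = 0\<^sub>m n n"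
    using no_pair mem a(2) e'(2,6) PQ unfolding no_nilpotent_pair_def by (metis P'_def mult_mem)
  then show False
    using PQ e'x x(2) \<rho>_zero by simp
qed

text \<open>Some idempotent e in \<open>A * y\<close> fixes a nonzero vector. For d in A the corners
  \<open>e * d * (1 - e)\<close> and \<open>(1 - e) * d * e\<close> square to zero on W, hence
  vanish there, so e commutes with the action of A. Its fixed space is then a nonzero
  \<H>-submodule, that is, all of W.\<close>

lemma acts_invertibly:
  assumes y: "y \<in> A" and w: "w \<in> W" "\<rho> y w \<noteq> 0"
  shows "\<exists>a\<in>A. \<forall>v\<in>W. \<rho> a (\<rho> y v) = v"
proof -
  obtain b x where b: "b \<in> A" and x: "x \<in> W" "x \<noteq> 0" "\<rho> (b * y) x = x"
    using fixed_vector y w by blast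
  then obtain e a where a: "a \<in> A" "e \<in> A" "e = a * (b * y)" and ee: "e * e = e" and ex: "\<rho> e x = x"
    using idempotent_of_fixed[OF mult_mem[OF b y] x(3) W_supp[OF x(1)]] by blast
  have eev: "\<rho> e (\<rho> e v) = \<rho> e v" for v
    using arg_cong[OF ee, of "\<lambda>t. \<rho> t v"] a by (simp add: \<rho>_mult)
  have comm: "\<rho> e (\<rho> d v) = \<rho> d (\<rho> e v)" if d: "d \<in> A" and v: "v \<in> W" for d v
  proof -
    have "\<rho> (e * d - e * (d * e)) v = 0"
      by (rule square_zero_imp_zero) (use a(2) d v in \<open>simp_all add: \<rho>_simps eev\<close>)
    moreover have "\<rho> (d * e - e * (d * e)) v = 0"
      by (rule square_zero_imp_zero) (use a(2) d v in \<open>simp_all add: \<rho>_simps eev\<close>)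
    ultimately show ?thesis
      using a d by (simp add: \<rho>_simps)
  qed
  have "qinvariant {v\<in>W. \<rho> e v = v}"
    by (rule qinvariantI) (use a comm in \<open>auto simp: \<rho>_simps\<close>)
  then have "{v\<in>W. \<rho> e v = v} = W"
    using W_min[of "{v\<in>W. \<rho> e v = v}"] x ex by auto
  then have "\<forall>v\<in>W. \<rho> (a * b) (\<rho> y v) = v"
    using a b y by (auto simp: \<rho>_mult)
  then show ?thesis
    using a b by (meson mult_mem)
qed

text \<open>Lets an identity between elements of A acting on W be checked at a single nonzero
  vector.\<close>

lemma zero_divisor_imp_zero:
  assumes "y \<in> A" "v \<in> W" "v \<noteq> 0" "\<rho> y v = 0" "w \<in> W"
  shows "\<rho> y w = 0"
  using acts_invertibly[of y w] assms \<rho>_0 by force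

end

section \<open>A common eigenvector\<close>

text \<open>Embeds the complex numbers as the span of 1 and i, so that the fundamental theorem of
  algebra can supply eigenvalues.\<close>

definition quat_of_complex :: "complex \<Rightarrow> quat" where
  "quat_of_complex c = Quat (Re c) (Im c) 0 0"

lemma quat_of_complex_simps [simp]:
  "quat_of_complex 0 = 0" "quat_of_complex 1 = 1" "quat_of_complex (- c) = - quat_of_complex c"
  "quat_of_complex (of_real r) = of_real r" "quat_of_complex c = 0 \<longleftrightarrow> c = 0"
  by (simp_all add: quat_of_complex_def quat_ops of_real_quat complex_eq_iff)

lemma quat_of_complex_add: "quat_of_complex (c + d) = quat_of_complex c + quat_of_complex d"
  by (simp add: quat_of_complex_def quat_ops)

lemma quat_of_complex_mult: "quat_of_complex (c * d) = quat_of_complex c * quat_of_complex d"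
  by (simp add: quat_of_complex_def quat_ops)

abbreviation quat_i :: quat where "quat_i \<equiv> Quat 0 1 0 0"
abbreviation quat_j :: quat where "quat_j \<equiv> Quat 0 0 1 0"

lemma quat_ij: "quat_i * quat_i = - 1" "quat_j * quat_j = - 1" "quat_j * quat_i = - (quat_i * quat_j)"
  by (simp_all add: quat_ops)

lemma rscale_2: "x \<triangleleft> 2 = x + x"
  using rscale_add[of x 1 1] by simp

section \<open>Complex polynomials acting on vectors\<close>

context mat_rep
begin

text \<open>A Horner scheme with the coefficients to the right of v. There they commute with y and,
  being complex, with one another, so vectors form a module over the complex polynomials with the
  variable acting as y.\<close>

definition poly_act :: "quat mat \<Rightarrow> complex poly \<Rightarrow> qvec \<Rightarrow> qvec" where
  "poly_act y p v = fold_coeffs (\<lambda>c w. v \<triangleleft> quat_of_complex c + \<rho> y w) p 0"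

lemma poly_act_0 [simp]: "poly_act y 0 v = 0"
  by (simp add: poly_act_def)

lemma poly_act_pCons:
  "y \<in> A \<Longrightarrow> poly_act y (pCons c p) v = v \<triangleleft> quat_of_complex c + \<rho> y (poly_act y p v)"
  by (cases "c = 0 \<and> p = 0") (auto simp: poly_act_def \<rho>_0)

lemma poly_act_add: "y \<in> A \<Longrightarrow> poly_act y (p + q) v = poly_act y p v + poly_act y q v"
  by (induction p q rule: poly_induct2)
    (simp_all add: poly_act_pCons \<rho>_simps quat_of_complex_add rscale_add algebra_simps)

lemma poly_act_smult: "y \<in> A \<Longrightarrow> poly_act y (smult c p) v = poly_act y p v \<triangleleft> quat_of_complex c"
  by (induction p) (simp_all add: poly_act_pCons \<rho>_simps mult.commute[of c] quat_of_complex_mult)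

lemma poly_act_diff: "y \<in> A \<Longrightarrow> poly_act y (p - q) v = poly_act y p v - poly_act y q v"
  using poly_act_add[of y p "- q" v] poly_act_smult[of y "- 1" q v] by simp

lemma poly_act_linear_factor:
  "y \<in> A \<Longrightarrow> poly_act y ([:- c, 1:] * q) v = \<rho> y (poly_act y q v) - poly_act y q v \<triangleleft> quat_of_complex c"
  by (simp add: poly_act_diff poly_act_pCons poly_act_smult poly_act_add)

end

section \<open>Eigenvectors and the quadratic equation of a single element\<close>

context irreducible_rep
begin

lemma poly_act_mem [simp]: "y \<in> A \<Longrightarrow> v \<in> W \<Longrightarrow> poly_act y p v \<in> W"
  by (induction p) (simp_all add: poly_act_pCons)

text \<open>The multiples of \<open>v0\<close> by \<open>monom 1 k * q\<close> form a descending
  chain; once it is stationary, some nonzero polynomial kills \<open>v0\<close>. Take a polynomial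
  of least degree killing some nonzero v and split off a linear factor: the cofactor does not kill
  v, and maps it to an eigenvector.\<close>

lemma eigenvector_exists:
  assumes y: "y \<in> A"
  shows "\<exists>v\<in>W. v \<noteq> 0 \<and> (\<exists>c. \<rho> y v = v \<triangleleft> quat_of_complex c)"
proof -
  obtain v0 where v0: "v0 \<in> W" "v0 \<noteq> 0"
    using W_nontrivial by blast
  define T where "T k = (\<lambda>q. poly_act y (monom 1 k * q) v0) ` UNIV" for k
  have "rsubspace (T k)" for k
    unfolding rsubspace_def T_def
  proof (safe, goal_cases)
    case 1
    show ?case
      by (rule image_eqI[of _ _ 0]) simp_all
  next
    case (2 _ p _ q)
    show ?case
      using y by (intro image_eqI[of _ _ "p + q"]) (simp_all add: poly_act_add ring_distribs)
  next
    case (3 _ p r)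
    show ?case
      using y by (intro image_eqI[of _ _ "smult (of_real r) p"]) (simp_all add: poly_act_smult)
  qed
  moreover have "T k \<subseteq> qsupp m" for k
    using y v0 by (auto simp: T_def)
  ultimately have "\<exists>S\<in>range T. \<forall>S'\<in>range T. S' \<subseteq> S \<longrightarrow> S' = S"
    by (intro rsubspace_minimal[of _ m]) auto
  then obtain k where k: "\<And>l. T l \<subseteq> T k \<Longrightarrow> T l = T k"
    by auto
  have "T (Suc k) \<subseteq> T k"
  proof (unfold T_def, safe)
    fix q
    show "poly_act y (monom 1 (Suc k) * q) v0 \<in> range (\<lambda>q. poly_act y (monom 1 k * q) v0)"
      by (rule image_eqI[of _ _ "monom 1 1 * q"]) (simp_all add: mult_monom flip: mult.assoc)
  qed
  then have "T (Suc k) = T k"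
    by (rule k)
  moreover have "poly_act y (monom 1 k) v0 \<in> T k"
    unfolding T_def by (rule image_eqI[of _ _ 1]) simp_all
  ultimately obtain q where q: "poly_act y (monom 1 k) v0 = poly_act y (monom 1 (Suc k) * q) v0"
    by (auto simp: T_def)
  \<comment> \<open>The second summand is divisible by \<open>monom 1 (Suc k)\<close>, so the
    coefficient at k survives and \<open>p0\<close> is not zero.\<close>
  define p0 where "p0 = monom 1 k - monom 1 (Suc k) * q"
  have "coeff p0 k = 1"
    by (simp add: p0_def coeff_monom_mult)
  then have "p0 \<noteq> 0"
    by auto
  moreover have "poly_act y p0 v0 = 0"
    using y q by (simp add: p0_def poly_act_diff)
  ultimately have "p0 \<noteq> 0 \<and> (\<exists>v\<in>W. v \<noteq> 0 \<and> poly_act y p0 v = 0)"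
    using v0 by blast
  then obtain p where p: "p \<noteq> 0" "\<exists>v\<in>W. v \<noteq> 0 \<and> poly_act y p v = 0"
    and least: "\<And>q. q \<noteq> 0 \<and> (\<exists>v\<in>W. v \<noteq> 0 \<and> poly_act y q v = 0) \<Longrightarrow> degree p \<le> degree q"
    using ex_has_least_nat[of "\<lambda>p. p \<noteq> 0 \<and> (\<exists>v\<in>W. v \<noteq> 0 \<and> poly_act y p v = 0)" p0 degree] by blast
  obtain v where v: "v \<in> W" "v \<noteq> 0" "poly_act y p v = 0"
    using p by blast
  have "degree p \<noteq> 0"
  proof
    assume "degree p = 0"
    then obtain c where "p = [:c:]"
      by (rule degree_eq_zeroE)
    then show False
      using p(1) v y by (simp add: poly_act_pCons \<rho>_0)
  qed
  then obtain c where "poly p c = 0"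
    using fundamental_theorem_of_algebra[of p] constant_degree[of p] by metis
  then obtain q where q: "p = [:- c, 1:] * q"
    using poly_eq_0_iff_dvd by (metis dvdE)
  have "q \<noteq> 0" "degree q < degree p"
    using p(1) q by (auto simp: degree_mult_eq simp del: mult_pCons_left)
  then have "poly_act y q v \<noteq> 0"
    using least[of q] v by force
  moreover have "\<rho> y (poly_act y q v) = poly_act y q v \<triangleleft> quat_of_complex c"
    using v(3) poly_act_linear_factor[OF y] unfolding q by simp
  ultimately show ?thesis
    using poly_act_mem[OF y v(1)] by metis
qed

text \<open>The real quadratic polynomial with roots a + is and a - is, evaluated at y, is an
  element of A that kills the eigenvector v, hence all of W.\<close>

lemma quadratic_equation:
  assumes y: "y \<in> A"
  shows "\<exists>a s v. v \<in> W \<and> v \<noteq> 0 \<and> \<rho> y v = v \<triangleleft> Quat a s 0 0 \<and>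
    (\<forall>w\<in>W. \<rho> y (\<rho> y w) = \<rho> y w \<triangleleft> of_real (2 * a) - w \<triangleleft> of_real (a\<^sup>2 + s\<^sup>2))"
proof -
  obtain v c where v: "v \<in> W" "v \<noteq> 0" "\<rho> y v = v \<triangleleft> quat_of_complex c"
    using eigenvector_exists[OF y] by blast
  define a s where "a = Re c" and "s = Im c"
  have yv: "\<rho> y v = v \<triangleleft> Quat a s 0 0"
    using v by (simp add: quat_of_complex_def a_def s_def)
  define t where "t = y * y - of_real (2 * a) \<cdot>\<^sub>m y + of_real (a\<^sup>2 + s\<^sup>2) \<cdot>\<^sub>m 1\<^sub>m n"
  have t: "t \<in> A" "\<rho> t w = \<rho> y (\<rho> y w) - \<rho> y w \<triangleleft> of_real (2 * a) + w \<triangleleft> of_real (a\<^sup>2 + s\<^sup>2)" if "w \<in> W" for w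
    using y that unfolding t_def
    by (simp_all only: minus_mem add_mem mult_mem smult_mem one_mem \<rho>_simps \<rho>_one W_supp)
  have "\<rho> t v = v \<triangleleft> (Quat a s 0 0 * Quat a s 0 0 - Quat a s 0 0 * of_real (2 * a) + of_real (a\<^sup>2 + s\<^sup>2))"
    using t(2)[OF v(1)] y unfolding yv by (simp only: \<rho>_scale yv rscale_simps rscale_add rscale_diff)
  also have "Quat a s 0 0 * Quat a s 0 0 - Quat a s 0 0 * of_real (2 * a) + of_real (a\<^sup>2 + s\<^sup>2) = 0"
    by (simp only: of_real_quat) (simp add: quat_ops power2_eq_square algebra_simps)
  finally have "\<rho> t w = 0" if "w \<in> W" for w
    using zero_divisor_imp_zero[of t v w] t(1) v that by simp
  then show ?thesis
    using v(1,2) yv t(2) by (intro exI[of _ a] exI[of _ s] exI[of _ v]) (auto simp: algebra_simps)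
qed

text \<open>Subtract the real part a of an eigenvalue of y and divide by its imaginary part s. If s
  were 0, then y - a would kill v and y would act as the real scalar a.\<close>

lemma imaginary_unit_exists:
  assumes y: "y \<in> A" and nonreal: "\<nexists>r. \<forall>w\<in>W. \<rho> y w = w \<triangleleft> of_real r"
  shows "\<exists>i\<in>A. (\<forall>w\<in>W. \<rho> i (\<rho> i w) = - w) \<and> (\<exists>v\<in>W. v \<noteq> 0 \<and> \<rho> i v = v \<triangleleft> quat_i)"
proof -
  obtain a s v where v: "v \<in> W" "v \<noteq> 0" "\<rho> y v = v \<triangleleft> Quat a s 0 0"
    using quadratic_equation[OF y] by blast
  define z where "z = y - of_real a \<cdot>\<^sub>m 1\<^sub>m n"
  have z: "z \<in> A" "\<And>w. w \<in> W \<Longrightarrow> \<rho> z w = \<rho> y w - w \<triangleleft> of_real a"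
    using y by (simp_all add: z_def \<rho>_simps \<rho>_one)
  have zv: "\<rho> z v = v \<triangleleft> Quat 0 s 0 0"
  proof -
    have "Quat a s 0 0 - of_real a = Quat 0 s 0 0"
      by (simp add: of_real_quat quat_ops)
    then show ?thesis
      using z v by (metis rscale_diff)
  qed
  have s: "s \<noteq> 0"
  proof
    assume "s = 0"
    then have "\<rho> z v = 0"
      using zv by (simp flip: zero_quat_def)
    then have "\<rho> y w = w \<triangleleft> of_real a" if "w \<in> W" for w
      using zero_divisor_imp_zero[of z v w] z v that by simp
    then show False
      using nonreal by blast
  qed
  define i where "i = of_real (1 / s) \<cdot>\<^sub>m z"
  have i: "i \<in> A" "\<rho> i v = v \<triangleleft> quat_i"
    using z s zv by (simp_all add: i_def \<rho>_smult del: of_real_divide)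
      (simp add: of_real_quat times_quat_def)
  have "\<rho> (i * i + 1\<^sub>m n) v = 0"
    using i v by (simp add: \<rho>_simps \<rho>_one quat_ij)
  then have "\<rho> i (\<rho> i w) = - w" if "w \<in> W" for w
    using zero_divisor_imp_zero[of "i * i + 1\<^sub>m n" v w] i v that
    by (simp add: \<rho>_simps \<rho>_one eq_neg_iff_add_eq_0)
  then show ?thesis
    using i v by blast
qed

end

lemma quat_i_2_neq_0: "quat_i \<noteq> 0" "(2::quat) \<noteq> 0"
  by (simp add: zero_quat_def, metis of_real_eq_0_iff of_real_numeral zero_neq_numeral)

section \<open>The argument of Frobenius\<close>

context irreducible_rep
begin

text \<open>Since y commutes with i, its quadratic equation factors on W as (y - a - s i)(y - a + s
  i) = 0, and one of the factors must vanish on W.\<close>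

lemma commuting_with_imaginary_unit:
  assumes i: "i \<in> A" "\<And>w. w \<in> W \<Longrightarrow> \<rho> i (\<rho> i w) = - w"
    and y: "y \<in> A" "\<And>w. w \<in> W \<Longrightarrow> \<rho> y (\<rho> i w) = \<rho> i (\<rho> y w)"
  shows "\<exists>r t. \<forall>w\<in>W. \<rho> y w = w \<triangleleft> of_real r + \<rho> i w \<triangleleft> of_real t"
proof -
  obtain a s where yy: "\<And>w. w \<in> W \<Longrightarrow>
      \<rho> y (\<rho> y w) = \<rho> y w \<triangleleft> of_real (2 * a) - w \<triangleleft> of_real (a\<^sup>2 + s\<^sup>2)"
    using quadratic_equation[OF y(1)] by blast
  define P where "P r = y - of_real a \<cdot>\<^sub>m 1\<^sub>m n - of_real r \<cdot>\<^sub>m i" for r :: real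
  have P: "P r \<in> A" "\<And>w. w \<in> W \<Longrightarrow> \<rho> (P r) w = \<rho> y w - w \<triangleleft> of_real a - \<rho> i w \<triangleleft> of_real r" for r
    using i y by (simp_all add: P_def \<rho>_simps \<rho>_one)
  have "\<rho> (P s) (\<rho> (P (- s)) w) = 0" if w: "w \<in> W" for w
  proof -
    have 1: "x \<triangleleft> of_real (2 * a) = x \<triangleleft> of_real a + x \<triangleleft> of_real a"
      "x \<triangleleft> of_real (a\<^sup>2 + s\<^sup>2) = x \<triangleleft> of_real (a * a) + x \<triangleleft> of_real (s * s)" for x
      unfolding mult_2 of_real_add rscale_add power2_eq_square by simp_all
    show ?thesis
      using w i y by (simp add: P \<rho>_simps yy[unfolded 1] mult.commute[of a s] flip: of_real_mult)
  qed
  \<comment> \<open>If \<open>P (- s)\<close> does not vanish on W, some nonzero value of it is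
    killed by \<open>P s\<close>.\<close>
  then have "(\<forall>w\<in>W. \<rho> (P s) w = 0) \<or> (\<forall>w\<in>W. \<rho> (P (- s)) w = 0)"
    using zero_divisor_imp_zero[OF P(1)[of s]] P(1) W_\<rho> by metis
  then obtain r where "\<forall>w\<in>W. \<rho> (P r) w = 0"
    by blast
  then show ?thesis
    using P by (intro exI[of _ a] exI[of _ r]) (simp add: algebra_simps)
qed

text \<open>A acts on W through the reals, the complex numbers or the quaternions. Any nonzero
  vector serves in the first case, an eigenvector of i in the second, and in the third a vector on
  which i and j act as right multiplication by \<open>quat_i\<close> and
  \<open>quat_j\<close>.\<close>

lemma common_eigenvector:
  "\<exists>v\<in>W. v \<noteq> 0 \<and> (\<forall>a\<in>A. \<exists>q. \<rho> a v = v \<triangleleft> q)"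
proof (cases "\<forall>y\<in>A. \<exists>r. \<forall>w\<in>W. \<rho> y w = w \<triangleleft> of_real r")
  case True
  then show ?thesis
    using W_nontrivial by blast
next
  case False
  then obtain i v1 where i: "i \<in> A" "\<And>w. w \<in> W \<Longrightarrow> \<rho> i (\<rho> i w) = - w"
    and v1: "v1 \<in> W" "v1 \<noteq> 0" "\<rho> i v1 = v1 \<triangleleft> quat_i"
    using imaginary_unit_exists by blast
  show ?thesis
  proof (cases "\<forall>y\<in>A. \<forall>w\<in>W. \<rho> y (\<rho> i w) = \<rho> i (\<rho> y w)")
    case True
    have "\<exists>q. \<rho> y v1 = v1 \<triangleleft> q" if yA: "y \<in> A" for y
    proof -
      have "\<rho> y (\<rho> i w) = \<rho> i (\<rho> y w)" if "w \<in> W" for w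
        using True yA that by blast
      then obtain r t where "\<rho> y v1 = v1 \<triangleleft> of_real r + \<rho> i v1 \<triangleleft> of_real t"
        using commuting_with_imaginary_unit[OF i yA] v1(1) by blast
      then show ?thesis
        using v1(3) by (metis rscale_add rscale_simps(4))
    qed
    then show ?thesis
      using v1 by blast
  next
    case False
    then obtain y w0 where y: "y \<in> A" and w0: "w0 \<in> W" "\<rho> y (\<rho> i w0) \<noteq> \<rho> i (\<rho> y w0)"
      by blast
    \<comment> \<open>Twice the part of y that anticommutes with i; it is nonzero on W because y
      does not commute with i there.\<close>
    define t where "t = y + i * y * i"
    have t: "t \<in> A" "\<And>w. w \<in> W \<Longrightarrow> \<rho> t w = \<rho> y w + \<rho> i (\<rho> y (\<rho> i w))"
      using y i by (simp_all add: t_def \<rho>_simps)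
    have ti: "\<rho> t (\<rho> i w) = - \<rho> i (\<rho> t w)" if "w \<in> W" for w
      using that i y t by (simp add: \<rho>_simps)
    have tw0: "\<rho> t w0 \<noteq> 0"
    proof
      assume "\<rho> t w0 = 0"
      then have "\<rho> i (\<rho> t w0) = 0"
        using i by (simp add: \<rho>_0)
      then show False
        using w0 i y t by (simp add: \<rho>_simps)
    qed
    obtain a s where tt: "\<And>w. w \<in> W \<Longrightarrow>
      \<rho> t (\<rho> t w) = \<rho> t w \<triangleleft> of_real (2 * a) - w \<triangleleft> of_real (a\<^sup>2 + s\<^sup>2)"
      using quadratic_equation[OF t(1)] by blast
    \<comment> \<open>Moving i past t changes the sign of t but not of its square, so the linear
      term of the quadratic equation must vanish.\<close>
    have "a = 0"
    proof (rule ccontr)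
      assume "a \<noteq> 0"
      define c d :: quat where "c = of_real (2 * a)" and "d = of_real (a\<^sup>2 + s\<^sup>2)"
      note tt' = tt[folded c_def d_def]
      have "\<rho> t (\<rho> t (\<rho> i w0)) = \<rho> i (\<rho> t (\<rho> t w0))"
        using ti w0 t(1) i(1) by (simp add: \<rho>_uminus)
      then have "\<rho> t (\<rho> i w0) \<triangleleft> c - \<rho> i w0 \<triangleleft> d = \<rho> i (\<rho> t w0 \<triangleleft> c - w0 \<triangleleft> d)"
        using tt'[of w0] tt'[of "\<rho> i w0"] w0(1) i(1) by simp
      then have "- (\<rho> i (\<rho> t w0) \<triangleleft> c) = \<rho> i (\<rho> t w0) \<triangleleft> c"
        using w0(1) i(1) t(1) by (simp add: ti \<rho>_simps)
      then have "- (\<rho> i (\<rho> t w0) \<triangleleft> of_real (2 * a)) = \<rho> i (\<rho> t w0) \<triangleleft> of_real (2 * a)"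
        unfolding c_def .
      then have "\<rho> i (\<rho> t w0) \<triangleleft> of_real (2 * a + 2 * a) = 0"
        unfolding of_real_add rscale_add by (metis add.right_inverse)
      moreover have "\<rho> i (\<rho> t w0) \<noteq> 0"
        using i(2)[of "\<rho> t w0"] tw0 t(1) w0(1) i(1) \<rho>_0 by force
      ultimately show False
        using \<open>a \<noteq> 0\<close> by (simp flip: of_real_add)
    qed
    then have tt: "\<rho> t (\<rho> t w) = - (w \<triangleleft> of_real (s * s))" if "w \<in> W" for w
      using tt[OF that] by (simp add: power2_eq_square)
    have "s \<noteq> 0"
      using square_zero_imp_zero[OF t(1) _ w0(1)] tt tw0 by force
    define j where "j = of_real (1 / s) \<cdot>\<^sub>m t"
    have j: "j \<in> A" "\<And>w. w \<in> W \<Longrightarrow> \<rho> j w = \<rho> t w \<triangleleft> of_real (1 / s)"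
      using t(1) by (simp_all add: j_def \<rho>_smult del: of_real_divide)
    have jj: "\<rho> j (\<rho> j w) = - w" if "w \<in> W" for w
      using that t(1) j \<open>s \<noteq> 0\<close> by (simp add: \<rho>_scale tt flip: of_real_mult)
    have ji: "\<rho> j (\<rho> i w) = - \<rho> i (\<rho> j w)" if "w \<in> W" for w
      using that t(1) i(1) j by (simp add: \<rho>_scale ti)
    have "\<exists>v\<in>W. v \<noteq> 0 \<and> \<rho> i v = v \<triangleleft> quat_i \<and> \<rho> j v = v \<triangleleft> quat_j"
    proof -
      \<comment> \<open>Twice a projection onto the vectors on which j acts as
        \<open>quat_j\<close>. It respects the eigenvalue \<open>quat_i\<close> because i, j and
        \<open>quat_i\<close>, \<open>quat_j\<close> both anticommute.\<close>
      define f where "f u = u - \<rho> j u \<triangleleft> quat_j" for u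
      have f: "f u \<in> W" "\<rho> i (f u) = f u \<triangleleft> quat_i" "\<rho> j (f u) = f u \<triangleleft> quat_j"
        if u: "u \<in> W" "\<rho> i u = u \<triangleleft> quat_i" for u
      proof -
        have "\<rho> i (\<rho> j u) = - \<rho> j u \<triangleleft> quat_i"
          using ji[of u] u j(1) by (simp add: \<rho>_scale)
        then show "f u \<in> W" "\<rho> i (f u) = f u \<triangleleft> quat_i" "\<rho> j (f u) = f u \<triangleleft> quat_j"
          using u j(1) i(1) jj by (simp_all add: f_def \<rho>_simps quat_ij)
      qed
      \<comment> \<open>If f killed both vectors, \<open>v1 \<triangleleft> quat_i\<close> would
        equal its own negative.\<close>
      have "f v1 \<noteq> 0 \<or> f (v1 \<triangleleft> quat_i) \<noteq> 0"
      proof (rule ccontr)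
        assume "\<not> ?thesis"
        then have 1: "v1 = \<rho> j v1 \<triangleleft> quat_j" and 2: "v1 \<triangleleft> quat_i = \<rho> j v1 \<triangleleft> (quat_i * quat_j)"
          using j(1) by (simp_all add: f_def \<rho>_scale)
        have "v1 \<triangleleft> quat_i = - (v1 \<triangleleft> quat_i)"
          using arg_cong[OF 1, of "\<lambda>x. x \<triangleleft> quat_i"] unfolding rscale_simps(4,8) quat_ij(3) 2[symmetric] .
        then have "v1 \<triangleleft> quat_i \<triangleleft> 2 = 0"
          unfolding rscale_2 by (metis add.right_inverse)
        then show False
          using v1(2) by (metis quat_i_2_neq_0 rscale_eq_0_iff)
      qed
      moreover have "\<rho> i (v1 \<triangleleft> quat_i) = v1 \<triangleleft> quat_i \<triangleleft> quat_i"
        using v1 i(1) by (simp add: \<rho>_scale)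
      ultimately show ?thesis
        using f[OF v1(1,3)] f[OF W_scale[OF v1(1)]] by blast
    qed
    then obtain v where v: "v \<in> W" "v \<noteq> 0" "\<rho> i v = v \<triangleleft> quat_i" "\<rho> j v = v \<triangleleft> quat_j"
      by blast
    have "\<exists>q. \<rho> y v = v \<triangleleft> q" if y: "y \<in> A" for y
    proof -
      \<comment> \<open>Twice the parts of y that commute and anticommute with i; they add up to 2
        y.\<close>
      define y1 y2 where "y1 = y - i * y * i" and "y2 = y + i * y * i"
      have y1: "y1 \<in> A" "\<And>w. w \<in> W \<Longrightarrow> \<rho> y1 w = \<rho> y w - \<rho> i (\<rho> y (\<rho> i w))"
        and y2: "y2 \<in> A" "\<And>w. w \<in> W \<Longrightarrow> \<rho> y2 w = \<rho> y w + \<rho> i (\<rho> y (\<rho> i w))"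
        using y i(1) by (simp_all add: y1_def y2_def \<rho>_simps)
      have "\<rho> y1 (\<rho> i w) = \<rho> i (\<rho> y1 w)" if "w \<in> W" for w
        using that y1 i y by (simp add: \<rho>_simps)
      then obtain r1 t1 where 1: "\<rho> y1 v = v \<triangleleft> of_real r1 + \<rho> i v \<triangleleft> of_real t1"
        using commuting_with_imaginary_unit[OF i y1(1)] v(1) by blast
      \<comment> \<open>Both \<open>y2\<close> and j anticommute with i, so their product commutes
        with it.\<close>
      have "\<rho> (y2 * j) (\<rho> i w) = \<rho> i (\<rho> (y2 * j) w)" if "w \<in> W" for w
        using that y2 i y j(1) by (simp add: \<rho>_simps ji)
      then obtain r2 t2 where "\<And>w. w \<in> W \<Longrightarrow>
          \<rho> (y2 * j) w = w \<triangleleft> of_real r2 + \<rho> i w \<triangleleft> of_real t2"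
        using commuting_with_imaginary_unit[OF i, of "y2 * j"] y2(1) j(1) by auto
      \<comment> \<open>Evaluating at \<open>\<rho> j v\<close> cancels the factor j up to sign,
        since j squares to -1.\<close>
      from this[of "\<rho> j v"] have 2: "- \<rho> y2 v = \<rho> j v \<triangleleft> of_real r2 + \<rho> i (\<rho> j v) \<triangleleft> of_real t2"
        using v(1) j(1) y2(1) by (simp add: \<rho>_mult \<rho>_uminus jj del: v)
      have "\<rho> y v \<triangleleft> 2 = \<rho> y1 v - (- \<rho> y2 v)"
        using v(1) y1 y2 by (simp add: rscale_2)
      also have "\<dots> = v \<triangleleft> (of_real r1 + quat_i * of_real t1 -
          (quat_j * of_real r2 + quat_i * quat_j * of_real t2))"
        using v(3,4) i(1) unfolding 1 2 by (simp add: \<rho>_scale rscale_add rscale_diff)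
      finally have "\<rho> y v \<triangleleft> 2 \<triangleleft> inverse 2 = v \<triangleleft> (of_real r1 + quat_i * of_real t1 -
          (quat_j * of_real r2 + quat_i * quat_j * of_real t2)) \<triangleleft> inverse 2"
        by simp
      moreover have "(2::quat) * inverse 2 = 1"
        by (metis of_real_numeral of_real_inverse of_real_mult of_real_1 right_inverse zero_neq_numeral)
      ultimately show ?thesis
        unfolding rscale_simps(4) by auto
    qed
    then show ?thesis
      using v(1,2) by blast
  qed
qed

end

section \<open>Triangularization\<close>

text \<open>Entries from m on are cut off, so values lie in \<open>qsupp m\<close> and the identity
  matrix acts as the identity only there.\<close>

definition mat_act :: "nat \<Rightarrow> quat mat \<Rightarrow> qvec \<Rightarrow> qvec" where
  "mat_act m M x = QVec (\<lambda>i. if i < m then \<Sum>j<m. M $$ (i, j) * entry x j else 0)"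

lemma entry_mat_act: "entry (mat_act m M x) i = (if i < m then \<Sum>j<m. M $$ (i, j) * entry x j else 0)"
  by (simp add: mat_act_def)

lemma index_mult_mat_sum:
  assumes "X \<in> carrier_mat a b" "Y \<in> carrier_mat b c" "i < a" "j < c"
  shows "(X * Y) $$ (i, j) = (\<Sum>k<b. X $$ (i, k) * Y $$ (k, j))"
  using assms by (simp add: scalar_prod_def atLeast0LessThan)

lemma mat_act_mult:
  assumes "M \<in> carrier_mat m m" "N \<in> carrier_mat m m"
  shows "mat_act m (M * N) x = mat_act m M (mat_act m N x)"
proof (unfold qvec_eq_iff, rule allI)
  fix i
  have "(\<Sum>j<m. (\<Sum>k<m. M $$ (i, k) * N $$ (k, j)) * entry x j) =
      (\<Sum>k<m. M $$ (i, k) * (\<Sum>j<m. N $$ (k, j) * entry x j))"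
    unfolding sum_distrib_left sum_distrib_right by (subst sum.swap) (simp add: mult.assoc)
  then show "entry (mat_act m (M * N) x) i = entry (mat_act m M (mat_act m N x)) i"
    using assms by (simp add: entry_mat_act index_mult_mat_sum[of _ m m _ m] del: index_mult_mat)
qed

text \<open>T is the identity matrix with its first column replaced by v; as \<open>v 0\<close> is
  invertible, column clearing gives the explicit inverse S.\<close>

lemma invertible_first_column_0:
  assumes v: "v 0 \<noteq> (0 :: quat)"
  shows "\<exists>S\<in>carrier_mat (Suc m) (Suc m). \<exists>T\<in>carrier_mat (Suc m) (Suc m).
    S * T = 1\<^sub>m (Suc m) \<and> T * S = 1\<^sub>m (Suc m) \<and> (\<forall>i<Suc m. T $$ (i, 0) = v i)"
proof -
  define T where "T = mat (Suc m) (Suc m) (\<lambda>(i, j). if j = 0 then v i else if i = j then 1 else 0)"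
  define S where "S = mat (Suc m) (Suc m) (\<lambda>(i, j). if j = 0 then (if i = 0 then inverse (v 0)
    else - (v i * inverse (v 0))) else if i = j then 1 else 0)"
  have ST: "S \<in> carrier_mat (Suc m) (Suc m)" "T \<in> carrier_mat (Suc m) (Suc m)"
    by (simp_all add: S_def T_def)
  have "S * T = 1\<^sub>m (Suc m)"
  proof (rule eq_matI)
    fix i j assume "i < dim_row (1\<^sub>m (Suc m))" "j < dim_col (1\<^sub>m (Suc m))"
    then have ij: "i < Suc m" "j < Suc m" by auto
    then have "(S * T) $$ (i, j) = S $$ (i, 0) * T $$ (0, j) + (\<Sum>k<m. S $$ (i, Suc k) * T $$ (Suc k, j))"
      by (simp only: index_mult_mat_sum[OF ST] sum.lessThan_Suc_shift)
    also have "\<dots> = 1\<^sub>m (Suc m) $$ (i, j)"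
      using ij v by (cases i; cases j) (auto simp: S_def T_def if_distrib[of "\<lambda>x. x * _"]
          if_distrib[of "\<lambda>x. _ * x"] mult.assoc sum_negf cong: if_cong)
    finally show "(S * T) $$ (i, j) = 1\<^sub>m (Suc m) $$ (i, j)" .
  qed (use ST in auto)
  moreover have "T * S = 1\<^sub>m (Suc m)"
  proof (rule eq_matI)
    fix i j assume "i < dim_row (1\<^sub>m (Suc m))" "j < dim_col (1\<^sub>m (Suc m))"
    then have ij: "i < Suc m" "j < Suc m" by auto
    then have "(T * S) $$ (i, j) = T $$ (i, 0) * S $$ (0, j) + (\<Sum>k<m. T $$ (i, Suc k) * S $$ (Suc k, j))"
      by (simp only: index_mult_mat_sum[OF ST(2,1)] sum.lessThan_Suc_shift)
    also have "\<dots> = 1\<^sub>m (Suc m) $$ (i, j)"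
      using ij v by (cases i; cases j) (auto simp: S_def T_def if_distrib[of "\<lambda>x. x * _"]
          if_distrib[of "\<lambda>x. _ * x"] mult.assoc sum_negf cong: if_cong)
    finally show "(T * S) $$ (i, j) = 1\<^sub>m (Suc m) $$ (i, j)" .
  qed (use ST in auto)
  ultimately show ?thesis
    using ST by (intro bexI[of _ S] bexI[of _ T]) (auto simp: T_def)
qed

text \<open>Swapping the indices 0 and k by a permutation matrix X, which is its own inverse, brings
  the nonzero entry to the top.\<close>

lemma invertible_first_column:
  assumes v: "v k \<noteq> (0 :: quat)" and k: "k < Suc m"
  shows "\<exists>S\<in>carrier_mat (Suc m) (Suc m). \<exists>T\<in>carrier_mat (Suc m) (Suc m).
    S * T = 1\<^sub>m (Suc m) \<and> T * S = 1\<^sub>m (Suc m) \<and> (\<forall>i<Suc m. T $$ (i, 0) = v i)"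
proof -
  define s where "s i = (if i = 0 then k else if i = k then 0 else i)" for i
  have s: "s (s i) = i" "i < Suc m \<Longrightarrow> s i < Suc m" "i = s l \<longleftrightarrow> l = s i" for i l
    using k by (auto simp: s_def)
  define X :: "quat mat" where "X = mat (Suc m) (Suc m) (\<lambda>(i, j). if j = s i then 1 else 0)"
  have X: "X \<in> carrier_mat (Suc m) (Suc m)"
    by (simp add: X_def)
  have Xmult: "(X * Y) $$ (i, j) = Y $$ (s i, j)"
    if "Y \<in> carrier_mat (Suc m) (Suc m)" "i < Suc m" "j < Suc m" for Y i j
  proof -
    have "(X * Y) $$ (i, j) = (\<Sum>l<Suc m. if l = s i then Y $$ (l, j) else 0)"
      unfolding index_mult_mat_sum[OF X that] by (rule sum.cong) (use that in \<open>auto simp: X_def\<close>)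
    then show ?thesis
      using s(2)[OF that(2)] by (simp add: sum.delta del: sum.lessThan_Suc)
  qed
  have XX: "X * X = 1\<^sub>m (Suc m)"
  proof (rule eq_matI)
    fix i j assume "i < dim_row (1\<^sub>m (Suc m))" "j < dim_col (1\<^sub>m (Suc m))"
    then show "(X * X) $$ (i, j) = 1\<^sub>m (Suc m) $$ (i, j)"
      using Xmult[OF X, of i j] s by (auto simp: X_def)
  qed (use X in auto)
  have "(v \<circ> s) 0 \<noteq> 0"
    using v by (simp add: s_def)
  then obtain S T where ST: "S \<in> carrier_mat (Suc m) (Suc m)" "T \<in> carrier_mat (Suc m) (Suc m)"
    "S * T = 1\<^sub>m (Suc m)" "T * S = 1\<^sub>m (Suc m)" "\<And>i. i < Suc m \<Longrightarrow> T $$ (i, 0) = v (s i)"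
    using invertible_first_column_0[of "v \<circ> s" m] by auto
  have "S * X * (X * T) = S * (X * X * T)" "X * T * (S * X) = X * (T * S * X)"
    using ST(1,2) X by (simp_all add: assoc_mult_mat[of _ "Suc m" "Suc m" _ "Suc m" _ "Suc m"])
  then have "S * X * (X * T) = 1\<^sub>m (Suc m)" "X * T * (S * X) = 1\<^sub>m (Suc m)"
    using ST(1-4) X XX by simp_all
  moreover have "(X * T) $$ (i, 0) = v i" if "i < Suc m" for i
    using Xmult[OF ST(2) that, of 0] ST(5)[of "s i"] s that by simp
  ultimately show ?thesis
    using ST(1,2) X by (intro bexI[of _ "S * X"] bexI[of _ "X * T"]) auto
qed

lemma conj_mult:
  fixes P Q X Y :: "'a::ring_1 mat"
  assumes "P \<in> carrier_mat n n" "Q \<in> carrier_mat n n" "Q * P = 1\<^sub>m n"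
    "X \<in> carrier_mat n n" "Y \<in> carrier_mat n n"
  shows "P * X * Q * (P * Y * Q) = P * (X * Y) * Q"
proof -
  have "P * X * Q * (P * Y * Q) = P * X * (Q * P * (Y * Q))"
    using assms(1,2,4,5) by (simp add: assoc_mult_mat[of _ n n _ n _ n])
  also have "\<dots> = P * (X * Y) * Q"
    using assms by (simp add: assoc_mult_mat[of _ n n _ n _ n])
  finally show ?thesis .
qed

lemma conj_inverse:
  fixes P Q X :: "'a::ring_1 mat"
  assumes "P \<in> carrier_mat n n" "Q \<in> carrier_mat n n" "Q * P = 1\<^sub>m n" "X \<in> carrier_mat n n"
  shows "Q * (P * X * Q) * P = X"
proof -
  have "Q * (P * X * Q) * P = Q * P * (X * (Q * P))"
    using assms(1,2,4) by (simp add: assoc_mult_mat[of _ n n _ n _ n])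
  then show ?thesis
    using assms by simp
qed

text \<open>Stated for a homomorphism \<sigma> rather than for A itself because the lower right
  block in the induction is again a representation of A; the condition on pairs then stays a
  condition on A.\<close>

lemma triangularizable_rep:
  assumes A: "unital_real_subalgebra n A" and no_pair: "no_nilpotent_pair n A"
    and \<sigma>: "\<And>a. a \<in> A \<Longrightarrow> \<sigma> a \<in> carrier_mat m m"
      "\<And>a b. a \<in> A \<Longrightarrow> b \<in> A \<Longrightarrow> \<sigma> (a + b) = \<sigma> a + \<sigma> b"
      "\<And>a b. a \<in> A \<Longrightarrow> b \<in> A \<Longrightarrow> \<sigma> (a * b) = \<sigma> a * \<sigma> b"
      "\<And>a r. a \<in> A \<Longrightarrow> \<sigma> (of_real r \<cdot>\<^sub>m a) = of_real r \<cdot>\<^sub>m \<sigma> a"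
      "\<sigma> (1\<^sub>m n) = 1\<^sub>m m"
  shows "triangularizable m (\<sigma> ` A)"
  using \<sigma>
proof (induction m arbitrary: \<sigma>)
  case 0
  show ?case
    unfolding triangularizable_def
    by (intro bexI[of _ "1\<^sub>m 0"]) (auto simp: inverts_mat_def dest!: "0.prems"(1))
next
  case (Suc m)
  note \<sigma> = Suc.prems
  interpret real_mat_algebra n A
    by unfold_locales (rule A)
  interpret mat_rep n A "Suc m" "\<lambda>a. mat_act (Suc m) (\<sigma> a)"
  proof (unfold_locales, goal_cases)
    case (1 a x y)
    show ?case
      by (simp add: qvec_eq_iff entry_mat_act sum.distrib distrib_left del: sum.lessThan_Suc)
  next
    case (2 a x q)
    show ?case
      by (simp add: qvec_eq_iff entry_mat_act sum_distrib_right mult.assoc del: sum.lessThan_Suc)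
  next
    case (3 a b x)
    then show ?case
      using \<sigma>(1)[of a] \<sigma>(1)[of b]
      by (simp add: qvec_eq_iff entry_mat_act \<sigma>(2) sum.distrib distrib_right del: sum.lessThan_Suc)
  next
    case (4 a b x)
    then show ?case
      by (simp add: \<sigma>(1,3) mat_act_mult)
  next
    case (5 a r x)
    then show ?case
      using \<sigma>(1)[of a] by (simp add: qvec_eq_iff entry_mat_act \<sigma>(4) sum_distrib_right
          sum_distrib_left mult.assoc of_real_quat_commute del: sum.lessThan_Suc)
  next
    case (6 x)
    have "(\<Sum>j<Suc m. 1\<^sub>m (Suc m) $$ (i, j) * entry x j) = entry x i" if "i < Suc m" for i
    proof -
      have "(\<Sum>j<Suc m. 1\<^sub>m (Suc m) $$ (i, j) * entry x j) = (\<Sum>j<Suc m. if j = i then entry x j else 0)"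
        by (rule sum.cong) (use that in auto)
      then show ?thesis
        using that by (simp add: sum.delta del: sum.lessThan_Suc)
    qed
    then show ?case
      using 6 by (simp add: qvec_eq_iff entry_mat_act \<sigma>(5) qsupp_def del: sum.lessThan_Suc)
  next
    case (7 a x)
    show ?case
      by (simp add: qsupp_def entry_mat_act)
  qed
  obtain W where W: "qinvariant W" "W \<noteq> {0}"
    "\<And>K. qinvariant K \<Longrightarrow> K \<subseteq> W \<Longrightarrow> K = {0} \<or> K = W"
    using minimal_qinvariant_exists by auto
  interpret irreducible_rep n A "Suc m" "\<lambda>a. mat_act (Suc m) (\<sigma> a)" W
    by unfold_locales (use W no_pair in blast)+
  obtain v where v: "v \<in> W" "v \<noteq> 0" and eig: "\<And>a. a \<in> A \<Longrightarrow> \<exists>q. mat_act (Suc m) (\<sigma> a) v = v \<triangleleft> q"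
    using common_eigenvector by blast
  obtain k where k: "entry v k \<noteq> 0"
    using v(2) by (auto simp: qvec_eq_iff)
  then have "k < Suc m"
    using W_supp[OF v(1)] by (auto simp: qsupp_def not_less[symmetric])
  \<comment> \<open>Change of basis with v as first basis vector: its line is invariant, so the
    first column of each conjugate vanishes below the corner.\<close>
  then obtain S T where S: "S \<in> carrier_mat (Suc m) (Suc m)" and T: "T \<in> carrier_mat (Suc m) (Suc m)"
    and ST: "S * T = 1\<^sub>m (Suc m)" and TS: "T * S = 1\<^sub>m (Suc m)"
    and Tv: "\<And>i. i < Suc m \<Longrightarrow> T $$ (i, 0) = entry v i"
    using invertible_first_column[of "entry v" k m] k by blast
  define B where "B a = S * \<sigma> a * T" for a
  have B: "B a \<in> carrier_mat (Suc m) (Suc m)" if "a \<in> A" for a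
    using S T \<sigma>(1)[OF that] by (simp add: B_def)
  have B_col: "B a $$ (Suc i, 0) = 0" if a: "a \<in> A" and i: "i < m" for a i
  proof -
    obtain q where q: "mat_act (Suc m) (\<sigma> a) v = v \<triangleleft> q"
      using eig[OF a] by blast
    have col: "(\<sigma> a * T) $$ (l, 0) = T $$ (l, 0) * q" if "l < Suc m" for l
    proof -
      have "(\<sigma> a * T) $$ (l, 0) = (\<Sum>j<Suc m. \<sigma> a $$ (l, j) * entry v j)"
        unfolding index_mult_mat_sum[OF \<sigma>(1)[OF a] T that zero_less_Suc] by (rule sum.cong) (simp_all add: Tv)
      also have "\<dots> = entry (v \<triangleleft> q) l"
        using that unfolding q[symmetric] entry_mat_act by simp
      finally show ?thesis
        using that by (simp add: Tv)
    qed
    have "B a $$ (Suc i, 0) = (\<Sum>l<Suc m. S $$ (Suc i, l) * (\<sigma> a * T) $$ (l, 0))"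
      using i S T \<sigma>(1)[OF a] unfolding B_def assoc_mult_mat[OF S \<sigma>(1)[OF a] T]
      by (intro index_mult_mat_sum) auto
    also have "\<dots> = (\<Sum>l<Suc m. S $$ (Suc i, l) * T $$ (l, 0)) * q"
      unfolding sum_distrib_right by (rule sum.cong) (simp_all add: col mult.assoc)
    also have "(\<Sum>l<Suc m. S $$ (Suc i, l) * T $$ (l, 0)) = (S * T) $$ (Suc i, 0)"
      using i by (intro index_mult_mat_sum[OF S T, symmetric]) auto
    finally show ?thesis
      using i ST by simp
  qed
  define \<tau> where "\<tau> a = mat m m (\<lambda>(i, j). B a $$ (Suc i, Suc j))" for a
  have \<tau>: "\<tau> a \<in> carrier_mat m m" for a
    by (simp add: \<tau>_def)
  have "triangularizable m (\<tau> ` A)"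
  proof (rule Suc.IH)
    fix a b assume ab: "a \<in> A" "b \<in> A"
    have "B (a + b) = B a + B b"
      using S T \<sigma>(1)[OF ab(1)] \<sigma>(1)[OF ab(2)]
      by (simp add: B_def \<sigma>(2) ab mult_add_distrib_mat[of _ "Suc m" "Suc m"]
          add_mult_distrib_mat[of _ "Suc m" "Suc m"])
    then show "\<tau> (a + b) = \<tau> a + \<tau> b"
      using B[OF ab(1)] B[OF ab(2)] by (auto simp: \<tau>_def intro!: eq_matI)
    have Bab: "B (a * b) = B a * B b"
      using conj_mult[OF S T TS \<sigma>(1)[OF ab(1)] \<sigma>(1)[OF ab(2)]] by (simp add: B_def \<sigma>(3) ab)
    show "\<tau> (a * b) = \<tau> a * \<tau> b"
    proof (rule eq_matI)
      fix i j assume "i < dim_row (\<tau> a * \<tau> b)" "j < dim_col (\<tau> a * \<tau> b)"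
      then have ij: "i < m" "j < m"
        by (simp_all add: \<tau>_def)
      have "B (a * b) $$ (Suc i, Suc j) = (\<Sum>l<Suc m. B a $$ (Suc i, l) * B b $$ (l, Suc j))"
        unfolding Bab using ij by (intro index_mult_mat_sum[OF B[OF ab(1)] B[OF ab(2)]]) auto
      \<comment> \<open>The term l = 0 drops out because the first column of \<open>B a\<close>
        vanishes below the corner; this makes the block multiplicative.\<close>
      also have "\<dots> = (\<Sum>l<m. \<tau> a $$ (i, l) * \<tau> b $$ (l, j))"
        unfolding sum.lessThan_Suc_shift using ij B_col[OF ab(1)] by (simp add: \<tau>_def)
      finally show "\<tau> (a * b) $$ (i, j) = (\<tau> a * \<tau> b) $$ (i, j)"
        using index_mult_mat_sum[OF \<tau> \<tau> ij, of a b] ij by (simp add: \<tau>_def)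
    qed (simp_all add: \<tau>_def)
  next
    fix a r assume a: "a \<in> A"
    have "B (of_real r \<cdot>\<^sub>m a) = of_real r \<cdot>\<^sub>m B a"
      using S T \<sigma>(1)[OF a] by (simp add: B_def \<sigma>(4) a of_real_smult_mult_mat[of _ "Suc m"])
    then show "\<tau> (of_real r \<cdot>\<^sub>m a) = of_real r \<cdot>\<^sub>m \<tau> a"
      using B[OF a] by (auto simp: \<tau>_def intro!: eq_matI)
  next
    have "B (1\<^sub>m n) = 1\<^sub>m (Suc m)"
      using S T ST by (simp add: B_def \<sigma>(5))
    then show "\<tau> (1\<^sub>m n) = 1\<^sub>m m"
      by (auto simp: \<tau>_def intro!: eq_matI)
  qed (rule \<tau>)
  then obtain P Q where P: "P \<in> carrier_mat m m" and Q: "Q \<in> carrier_mat m m"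
    and PQ: "P * Q = 1\<^sub>m m" and QP: "Q * P = 1\<^sub>m m"
    and tri: "\<And>a. a \<in> A \<Longrightarrow> upper_triangular (P * \<tau> a * Q)"
    unfolding triangularizable_def inverts_mat_def by auto
  \<comment> \<open>Extends a change of basis of the block to the whole space, leaving the first
    basis vector alone.\<close>
  define E where "E X = four_block_mat (1\<^sub>m 1) (0\<^sub>m 1 m) (0\<^sub>m m 1) X" for X :: "quat mat"
  have E: "E X \<in> carrier_mat (Suc m) (Suc m)" if "X \<in> carrier_mat m m" for X
    using four_block_carrier_mat[of "1\<^sub>m 1" 1 1 X m m] that by (simp add: E_def)
  have E_mult: "E X * E Y = E (X * Y)" if "X \<in> carrier_mat m m" "Y \<in> carrier_mat m m" for X Y
    unfolding E_def using that
    by (subst mult_four_block_mat[of _ 1 1 _ m _ m _ _ 1 _ m]) auto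
  have E_one: "E (1\<^sub>m m) = 1\<^sub>m (Suc m)"
    by (simp add: E_def)
  note EP = E[OF P] and EQ = E[OF Q]
  have "E P * S * (T * E Q) = 1\<^sub>m (Suc m)" "T * E Q * (E P * S) = 1\<^sub>m (Suc m)"
  proof -
    have "E P * S * (T * E Q) = E P * (S * T * E Q)" "T * E Q * (E P * S) = T * (E Q * E P * S)"
      using EP EQ S T by (simp_all add: assoc_mult_mat[of _ "Suc m" "Suc m" _ "Suc m" _ "Suc m"])
    then show "E P * S * (T * E Q) = 1\<^sub>m (Suc m)" "T * E Q * (E P * S) = 1\<^sub>m (Suc m)"
      using EP EQ S T P Q by (simp_all add: ST TS E_mult PQ QP E_one)
  qed
  moreover have "upper_triangular (E P * S * \<sigma> a * (T * E Q))" if a: "a \<in> A" for a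
  proof -
    define b where "b = mat 1 1 (\<lambda>_. B a $$ (0, 0))"
    define c where "c = mat 1 m (\<lambda>(i, j). B a $$ (0, Suc j))"
    have bc: "b \<in> carrier_mat 1 1" "c \<in> carrier_mat 1 m"
      by (simp_all add: b_def c_def)
    have "B a = four_block_mat b c (0\<^sub>m m 1) (\<tau> a)"
    proof (rule eq_matI)
      fix i j assume "i < dim_row (four_block_mat b c (0\<^sub>m m 1) (\<tau> a))"
        "j < dim_col (four_block_mat b c (0\<^sub>m m 1) (\<tau> a))"
      then have "i < Suc m" "j < Suc m"
        by (simp_all add: b_def c_def \<tau>_def)
      then show "B a $$ (i, j) = four_block_mat b c (0\<^sub>m m 1) (\<tau> a) $$ (i, j)"
        using B_col[OF a] by (cases i; cases j) (auto simp: b_def c_def \<tau>_def)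
    qed (use B[OF a] in \<open>simp_all add: b_def c_def \<tau>_def\<close>)
    then have "E P * B a * E Q = four_block_mat b (c * Q) (0\<^sub>m m 1) (P * \<tau> a * Q)"
      unfolding E_def using bc P Q \<tau>[of a]
      by (simp add: mult_four_block_mat[of _ 1 1 _ m _ m _ _ 1 _ m])
    moreover have "E P * S * \<sigma> a * (T * E Q) = E P * B a * E Q"
      using EP EQ S T \<sigma>(1)[OF a] unfolding B_def
      by (simp add: assoc_mult_mat[of _ "Suc m" "Suc m" _ "Suc m" _ "Suc m"])
    moreover have "upper_triangular (four_block_mat b (c * Q) (0\<^sub>m m 1) (P * \<tau> a * Q))"
      using bc P Q \<tau>[of a] tri[OF a] by (intro upper_triangular_four_block[of _ 1 _ m]) (auto simp: b_def)
    ultimately show ?thesis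
      by simp
  qed
  ultimately show ?case
    unfolding triangularizable_def inverts_mat_def using EP EQ S T
    by (intro bexI[of _ "E P * S"] bexI[of _ "T * E Q"]) auto
qed

section \<open>Nilpotent matrices and traces\<close>

lemma no_nilpotent_pair_imp_triangularizable:
  assumes "unital_real_subalgebra n A" "no_nilpotent_pair n A"
  shows "triangularizable n A"
  using triangularizable_rep[OF assms, of id n] assms(1)
  by (auto simp: unital_real_subalgebra_def)

section \<open>Diagonals of triangular matrices and nilpotency\<close>

lemma upper_triangular_mult_entry:
  fixes S T :: "'a::semiring_0 mat"
  assumes S: "S \<in> carrier_mat n n" "upper_triangular S" and T: "T \<in> carrier_mat n n" "upper_triangular T"
    and ij: "j \<le> i" "i < n"
  shows "(S * T) $$ (i, j) = (if i = j then S $$ (i, i) * T $$ (i, i) else 0)"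
proof -
  have "(S * T) $$ (i, j) = (\<Sum>k<n. S $$ (i, k) * T $$ (k, j))"
    using ij by (intro index_mult_mat_sum[OF S(1) T(1)]) auto
  also have "\<dots> = (\<Sum>k<n. if k = i then (if i = j then S $$ (i, i) * T $$ (i, i) else 0) else 0)"
  proof (rule sum.cong)
    fix k assume "k \<in> {..<n}"
    then show "S $$ (i, k) * T $$ (k, j) = (if k = i then (if i = j then S $$ (i, i) * T $$ (i, i) else 0) else 0)"
      using S T ij upper_triangularD[OF S(2), of k i] upper_triangularD[OF T(2), of j k]
      by (cases k i rule: linorder_cases) auto
  qed simp
  finally show ?thesis
    using ij by simp
qed

lemma upper_triangular_mult:
  fixes S T :: "'a::semiring_0 mat"
  assumes "S \<in> carrier_mat n n" "upper_triangular S" "T \<in> carrier_mat n n" "upper_triangular T"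
  shows "upper_triangular (S * T)"
  using assms upper_triangular_mult_entry[OF assms] by (intro upper_triangularI) auto

lemma upper_triangular_power:
  fixes T :: "'a::semiring_1 mat"
  assumes T: "T \<in> carrier_mat n n" "upper_triangular T"
  shows "upper_triangular (T ^\<^sub>m k) \<and> (\<forall>i<n. (T ^\<^sub>m k) $$ (i, i) = T $$ (i, i) ^ k)"
proof (induction k)
  case 0
  then show ?case
    using T by auto
next
  case (Suc k)
  then show ?case
    using upper_triangular_mult[of "T ^\<^sub>m k" n T] upper_triangular_mult_entry[of "T ^\<^sub>m k" n T] T
      pow_carrier_mat[OF T(1)] by (simp add: power_commutes)
qed

text \<open>Diagonal entries of a power are powers in a division ring, which gives one direction.
  For the other, each factor with zero diagonal pushes the nonzero entries one diagonal further up,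
  so the n-th power vanishes.\<close>

lemma nilpotent_upper_triangular_iff:
  assumes T: "T \<in> carrier_mat n n" "upper_triangular T"
  shows "nilpotent_mat n T \<longleftrightarrow> (\<forall>i<n. T $$ (i, i) = 0)"
proof
  assume "nilpotent_mat n T"
  then obtain k where "T ^\<^sub>m k = 0\<^sub>m n n"
    by (auto simp: nilpotent_mat_def)
  then show "\<forall>i<n. T $$ (i, i) = 0"
    using upper_triangular_power[OF T, of k] by simp
next
  assume diag: "\<forall>i<n. T $$ (i, i) = 0"
  have "(T ^\<^sub>m k) $$ (i, j) = 0" if "i < n" "j < n" "j < i + k" for i j k
    using that
  proof (induction k arbitrary: j)
    case 0
    then show ?case
      using T by simp
  next
    case (Suc k)
    have "(T ^\<^sub>m k) $$ (i, l) * T $$ (l, j) = 0" if "l < n" for l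
    proof (cases "l < i + k")
      case True
      then show ?thesis
        using Suc that by simp
    next
      case False
      then have "j \<le> l"
        using Suc.prems by simp
      then show ?thesis
        using that diag T upper_triangularD[OF T(2), of j l] by (cases "j = l") auto
    qed
    then show ?case
      unfolding pow_mat.simps index_mult_mat_sum[OF pow_carrier_mat[OF T(1), of k] T(1) Suc.prems(1,2)]
      by (intro sum.neutral) blast
  qed
  then have "T ^\<^sub>m n = 0\<^sub>m n n"
    using pow_carrier_mat[OF T(1), of n] by (intro eq_matI) auto
  then show "nilpotent_mat n T"
    by (auto simp: nilpotent_mat_def)
qed

lemma conj_power:
  fixes P Q X :: "'a::ring_1 mat"
  assumes "P \<in> carrier_mat n n" "Q \<in> carrier_mat n n" "P * Q = 1\<^sub>m n" "Q * P = 1\<^sub>m n" "X \<in> carrier_mat n n"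
  shows "(P * X * Q) ^\<^sub>m k = P * X ^\<^sub>m k * Q"
proof (induction k)
  case 0
  then show ?case
    using assms by simp
next
  case (Suc k)
  then show ?case
    using conj_mult[OF assms(1,2,4) pow_carrier_mat[OF assms(5), of k] assms(5)] by simp
qed

lemma nilpotent_conj_iff:
  assumes "P \<in> carrier_mat n n" "Q \<in> carrier_mat n n" "P * Q = 1\<^sub>m n" "Q * P = 1\<^sub>m n" "X \<in> carrier_mat n n"
  shows "nilpotent_mat n (P * X * Q) \<longleftrightarrow> nilpotent_mat n X"
proof -
  have "P * X ^\<^sub>m k * Q = 0\<^sub>m n n \<longleftrightarrow> X ^\<^sub>m k = 0\<^sub>m n n" for k
  proof
    assume "P * X ^\<^sub>m k * Q = 0\<^sub>m n n"
    then show "X ^\<^sub>m k = 0\<^sub>m n n"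
      using conj_inverse[OF assms(1,2,4) pow_carrier_mat[OF assms(5), of k]] assms(1,2) by simp
  qed (use assms in simp)
  then show ?thesis
    unfolding nilpotent_mat_def conj_power[OF assms] by simp
qed

section \<open>The quaternionic trace\<close>

lemma qRe_sum: "qRe (sum f I) = (\<Sum>i\<in>I. qRe (f i))"
  by (induction I rule: infinite_finite_induct) (simp_all add: plus_quat_def zero_quat_def)

lemma qTr_eq: "qTr X = 2 * (\<Sum>i<dim_row X. qRe (X $$ (i, i)))"
  by (simp add: qTr_def qRe_sum plus_quat_def flip: mult_2 sum_distrib_left)

text \<open>Entries do not commute, but \<open>qRe (p * q) = qRe (q * p)\<close>, and this trace
  sees only real parts.\<close>

lemma qTr_mult_commute:
  assumes "X \<in> carrier_mat n n" "Y \<in> carrier_mat n n"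
  shows "qTr (X * Y) = qTr (Y * X)"
proof -
  have tr: "qTr (X * Y) = 2 * (\<Sum>i<n. \<Sum>k<n. qRe (X $$ (i, k) * Y $$ (k, i)))"
    if "X \<in> carrier_mat n n" "Y \<in> carrier_mat n n" for X Y
    using that by (simp add: qTr_eq qRe_sum index_mult_mat_sum[OF that] del: index_mult_mat(1))
  have "(\<Sum>i<n. \<Sum>k<n. qRe (X $$ (i, k) * Y $$ (k, i))) = (\<Sum>k<n. \<Sum>i<n. qRe (Y $$ (k, i) * X $$ (i, k)))"
    by (subst sum.swap) (simp add: times_quat_def mult.commute)
  then show ?thesis
    using tr assms by simp
qed

lemma qTr_conj:
  assumes "P \<in> carrier_mat n n" "Q \<in> carrier_mat n n" "Q * P = 1\<^sub>m n" "X \<in> carrier_mat n n"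
  shows "qTr (P * X * Q) = qTr X"
proof -
  have "qTr (P * X * Q) = qTr (Q * (P * X))"
    using assms by (intro qTr_mult_commute[of _ n]) auto
  also have "Q * (P * X) = Q * P * X"
    using assms(1,2,4) by (simp add: assoc_mult_mat[of _ n n _ n _ n])
  finally show ?thesis
    using assms by simp
qed

lemma qTr_minus:
  assumes "X \<in> carrier_mat n n" "Y \<in> carrier_mat n n"
  shows "qTr (X - Y) = qTr X - qTr Y"
  using assms by (simp add: qTr_eq minus_quat_def sum_subtractf algebra_simps)

text \<open>The real span of 1 and e is a commutative algebra, so it contains no forbidden pair and
  the triangularization result applies to it. In triangular form the trace counts the ones on the
  diagonal of e; if there are none, e is both nilpotent and idempotent.\<close>

lemma idempotent_trace_nonpos_imp_zero:
  assumes e: "e \<in> carrier_mat n n" "e * e = e" and tr: "qTr e \<le> 0"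
  shows "e = 0\<^sub>m n n"
proof -
  define el where "el r t = of_real r \<cdot>\<^sub>m 1\<^sub>m n + of_real t \<cdot>\<^sub>m e" for r t :: real
  define A where "A = {el r t |r t. True}"
  have el: "el r t \<in> carrier_mat n n" for r t
    using e by (simp add: el_def)
  have el_add: "el r t + el r' t' = el (r + r') (t + t')" for r t r' t'
    using e by (intro eq_matI) (auto simp: el_def algebra_simps)
  have el_smult: "of_real s \<cdot>\<^sub>m el r t = el (s * r) (s * t)" for s r t
    using e by (intro eq_matI) (auto simp: el_def distrib_left mult.assoc)
  have el_mult: "el r t * el r' t' = el (r * r') (r * t' + t * r' + t * t')" for r t r' t'
  proof -
    have "el r t * el r' t' = of_real r \<cdot>\<^sub>m el r' t' + of_real t \<cdot>\<^sub>m (e * el r' t')"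
      using e el by (simp add: el_def[of r t] add_mult_distrib_mat[of _ n n _ _ n]
          of_real_smult_mult_mat[of _ n] left_mult_one_mat[OF el])
    also have "e * el r' t' = el 0 (r' + t')"
      using e by (simp add: el_def mult_add_distrib_mat[of _ n n _ n] of_real_smult_mult_mat[of _ n])
        (auto intro!: eq_matI simp: algebra_simps)
    finally show ?thesis
      by (simp only: el_smult el_add) (simp add: algebra_simps)
  qed
  have "el 1 0 = 1\<^sub>m n" "el 0 1 = e"
    using e by (auto simp: el_def intro!: eq_matI)
  then have eA: "e \<in> A" and A: "unital_real_subalgebra n A"
    unfolding unital_real_subalgebra_def A_def
    using el by (force, auto simp: el_add el_mult el_smult) (metis, blast+)
  interpret real_mat_algebra n A
    by unfold_locales (rule A)
  have comm: "X * Y = Y * X" if "X \<in> A" "Y \<in> A" for X Y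
    using that by (auto simp: A_def el_mult mult.commute add.commute)
  have "no_nilpotent_pair n A"
    unfolding no_nilpotent_pair_def
  proof (intro ballI impI)
    fix X Y assume XY: "X \<in> A" "Y \<in> A" and "X * X = 0\<^sub>m n n" "X * Y * (X * Y) = X * Y"
    moreover have "X * Y * (X * Y) = Y * (X * X * Y)"
      using comm[OF XY] XY by simp
    ultimately show "X * Y = 0\<^sub>m n n"
      by simp
  qed
  then obtain P Q where P: "P \<in> carrier_mat n n" and Q: "Q \<in> carrier_mat n n"
    and PQ: "P * Q = 1\<^sub>m n" and QP: "Q * P = 1\<^sub>m n" and tri: "upper_triangular (P * e * Q)"
    using no_nilpotent_pair_imp_triangularizable[OF A] eA
    unfolding triangularizable_def inverts_mat_def by auto
  define T where "T = P * e * Q"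
  have T: "T \<in> carrier_mat n n" "upper_triangular T"
    using P Q e tri by (simp_all add: T_def)
  have TT: "T * T = T"
    using conj_mult[OF P Q QP e(1) e(1)] e by (simp add: T_def)
  \<comment> \<open>Each diagonal entry is an idempotent of the division ring of
    quaternions.\<close>
  have diag: "T $$ (i, i) = 0 \<or> T $$ (i, i) = 1" if "i < n" for i
    using upper_triangular_mult_entry[OF T T order.refl that] by (simp add: TT)
  have nonneg: "0 \<le> qRe (T $$ (i, i))" if "i < n" for i
    using diag[OF that] by (auto simp: zero_quat_def one_quat_def)
  have "(\<Sum>i<n. qRe (T $$ (i, i))) \<le> 0"
    using tr qTr_conj[OF P Q QP e(1)] T by (simp add: qTr_eq flip: T_def)
  then have "\<forall>i<n. qRe (T $$ (i, i)) = 0"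
    using nonneg sum_nonneg_eq_0_iff[of "{..<n}" "\<lambda>i. qRe (T $$ (i, i))"]
    by (metis (no_types, lifting) finite_lessThan lessThan_iff order_antisym sum_nonneg)
  then have "\<forall>i<n. T $$ (i, i) = 0"
    using diag by (metis one_quat_def quat.sel(1) zero_neq_one)
  then obtain k where k: "T ^\<^sub>m k = 0\<^sub>m n n"
    using nilpotent_upper_triangular_iff[OF T] by (auto simp: nilpotent_mat_def)
  have "T ^\<^sub>m k * T = T"
    by (induction k) (use T TT in \<open>simp_all add: assoc_mult_mat[of _ n n _ n _ n]\<close>)
  then have "T = 0\<^sub>m n n"
    using k T by simp
  then show ?thesis
    using conj_inverse[OF P Q QP e(1)] P Q by (simp add: T_def)
qed

section \<open>Each of the three conditions excludes nilpotent pairs\<close>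

context real_mat_algebra
begin

lemma nilpotent_idempotent:
  assumes "e \<in> A" "e * e = e" "nilpotent_mat n e"
  shows "e = 0\<^sub>m n n"
proof -
  obtain k where "e ^\<^sub>m k = 0\<^sub>m n n"
    using assms(3) by (auto simp: nilpotent_mat_def)
  moreover have "e ^\<^sub>m k * e = e"
    by (induction k) (use assms in simp_all)
  ultimately show ?thesis
    using assms(1) by simp
qed

lemma square_zero_mult: "P \<in> A \<Longrightarrow> X \<in> A \<Longrightarrow> P * P = 0\<^sub>m n n \<Longrightarrow> P * (P * X) = 0\<^sub>m n n"
  by (metis alg_simps(1) unit_simps(2))

lemma square_zero_nilpotent: "P \<in> A \<Longrightarrow> P * P = 0\<^sub>m n n \<Longrightarrow> nilpotent_mat n P"
  unfolding nilpotent_mat_def by (rule exI[of _ 2]) (simp add: numeral_2_eq_2)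

lemma sum_closed_imp_no_nilpotent_pair:
  assumes "\<And>X Y. X \<in> A \<Longrightarrow> Y \<in> A \<Longrightarrow> nilpotent_mat n X \<Longrightarrow> nilpotent_mat n Y \<Longrightarrow> nilpotent_mat n (X + Y)"
  shows "no_nilpotent_pair n A"
  unfolding no_nilpotent_pair_def
proof (intro ballI impI)
  fix P Q assume PQ: "P \<in> A" "Q \<in> A" "P * P = 0\<^sub>m n n" "Q * Q = 0\<^sub>m n n" and e: "P * Q * (P * Q) = P * Q"
  define N where "N = P + Q"
  have N: "N \<in> A"
    using PQ by (simp add: N_def)
  obtain k where k: "N ^\<^sub>m k = 0\<^sub>m n n"
    using assms[OF PQ(1,2)] PQ square_zero_nilpotent unfolding N_def nilpotent_mat_def[of n "P + Q"] by blast
  have PP: "P * (P * X) = 0\<^sub>m n n" "Q * (Q * X) = 0\<^sub>m n n" if "X \<in> A" for X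
    using PQ that square_zero_mult by blast+
  \<comment> \<open>N sends \<open>P * Q\<close> to \<open>Q * (P * Q)\<close> and that back to
    \<open>P * Q\<close>.\<close>
  have NN: "N * (N * (P * Q)) = P * Q"
    using PQ PP e by (simp add: N_def)
  \<comment> \<open>Only even powers of N are known to fix \<open>P * Q\<close>, so the vanishing
    power is squared below.\<close>
  have "N ^\<^sub>m (2 * j) * (P * Q) = P * Q" for j
    by (induction j) (use PQ N NN in simp_all)
  then have "N ^\<^sub>m k * N ^\<^sub>m k * (P * Q) = P * Q"
    using pow_add[OF N, of k k] by (metis mult_2)
  then show "P * Q = 0\<^sub>m n n"
    using k PQ by simp
qed

lemma product_closed_imp_no_nilpotent_pair:
  assumes "\<And>X Y. X \<in> A \<Longrightarrow> Y \<in> A \<Longrightarrow> nilpotent_mat n X \<Longrightarrow> nilpotent_mat n (X * Y)"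
  shows "no_nilpotent_pair n A"
  unfolding no_nilpotent_pair_def
  using assms square_zero_nilpotent nilpotent_idempotent mult_mem by blast

lemma trace_commutator_imp_no_nilpotent_pair:
  assumes "\<And>X Y. X \<in> A \<Longrightarrow> Y \<in> A \<Longrightarrow> qTr (commutator X Y ^\<^sub>m 2) \<le> 0"
  shows "no_nilpotent_pair n A"
  unfolding no_nilpotent_pair_def
proof (intro ballI impI)
  fix P Q assume PQ: "P \<in> A" "Q \<in> A" "P * P = 0\<^sub>m n n" "Q * Q = 0\<^sub>m n n" and e: "P * Q * (P * Q) = P * Q"
  have PP: "P * (P * X) = 0\<^sub>m n n" "Q * (Q * X) = 0\<^sub>m n n" if "X \<in> A" for X
    using PQ that square_zero_mult by blast+
  \<comment> \<open>The mixed terms contain \<open>P * P\<close> or \<open>Q * Q\<close>. The two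
    that remain have equal trace by cyclicity; the second is written as a subtracted difference so
    that \<open>qTr_minus\<close> applies.\<close>
  have "commutator P Q ^\<^sub>m 2 = P * Q - (0\<^sub>m n n - Q * (P * (Q * P)))"
    using PQ PP e by (simp add: numeral_2_eq_2 commutator_def)
  moreover have "qTr (Q * (P * (Q * P))) = qTr (P * (Q * P) * Q)"
    using PQ by (intro qTr_mult_commute[of _ n]) auto
  moreover have "P * (Q * P) * Q = P * Q"
    using PQ e by simp
  moreover have "qTr (0\<^sub>m n n) = 0"
    by (simp add: qTr_eq zero_quat_def)
  ultimately have "qTr (commutator P Q ^\<^sub>m 2) = 2 * qTr (P * Q)"
    using PQ by (simp add: qTr_minus[of _ n])
  then show "P * Q = 0\<^sub>m n n"
    using assms[OF PQ(1,2)] PQ e by (intro idempotent_trace_nonpos_imp_zero) auto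
qed

end

section \<open>Triangularizable algebras satisfy the conditions\<close>

lemma qRe_commutator_square: "qRe ((p * q - q * p) * (p * q - q * p)) \<le> 0"
proof -
  \<comment> \<open>The square of a purely imaginary quaternion is minus its squared norm.\<close>
  have "qRe (x * x) \<le> 0" if "qRe x = 0" for x
    using that by (simp add: times_quat_def) (smt (verit) zero_le_square)
  moreover have "qRe (p * q - q * p) = 0"
    by (simp add: quat_ops)
  ultimately show ?thesis
    by blast
qed

text \<open>After conjugation the diagonal is additive and multiplicative and detects nilpotency, so
  sums and products are settled entry by entry in \<H>. The trace becomes a sum of real parts of
  squared commutators of quaternions, none of them positive.\<close>

lemma triangularizable_imp:
  assumes A: "unital_real_subalgebra n A" and tri: "triangularizable n A"
    and X: "X \<in> A" and Y: "Y \<in> A"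
  shows "nilpotent_mat n X \<Longrightarrow> nilpotent_mat n Y \<Longrightarrow> nilpotent_mat n (X + Y)"
    and "nilpotent_mat n X \<or> nilpotent_mat n Y \<Longrightarrow> nilpotent_mat n (X * Y)"
    and "qTr (commutator X Y ^\<^sub>m 2) \<le> 0"
proof -
  interpret real_mat_algebra n A
    by unfold_locales (rule A)
  obtain P Q where PQ: "P \<in> carrier_mat n n" "Q \<in> carrier_mat n n" "P * Q = 1\<^sub>m n" "Q * P = 1\<^sub>m n"
    and ut: "\<And>Z. Z \<in> A \<Longrightarrow> upper_triangular (P * Z * Q)"
    using tri unfolding triangularizable_def inverts_mat_def by auto
  define f where "f Z = P * Z * Q" for Z
  have f: "f Z \<in> carrier_mat n n" "upper_triangular (f Z)" if "Z \<in> A" for Z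
    using mult_carrier_mat[OF mult_carrier_mat[OF PQ(1) carr[OF that]] PQ(2)] ut[OF that]
    by (simp_all add: f_def)
  have nil: "nilpotent_mat n Z \<longleftrightarrow> (\<forall>i<n. f Z $$ (i, i) = 0)" if "Z \<in> A" for Z
    using nilpotent_conj_iff[OF PQ carr[OF that]] nilpotent_upper_triangular_iff[OF f[OF that]]
    by (simp add: f_def)
  have f_add: "f (Z + Z') = f Z + f Z'" and f_minus: "f (Z - Z') = f Z - f Z'"
    and f_mult: "f (Z * Z') = f Z * f Z'" if "Z \<in> A" "Z' \<in> A" for Z Z'
  proof -
    note Z = carr[OF that(1)] carr[OF that(2)]
    note PZ = mult_carrier_mat[OF PQ(1) Z(1)] mult_carrier_mat[OF PQ(1) Z(2)]
    show "f (Z + Z') = f Z + f Z'" "f (Z - Z') = f Z - f Z'" "f (Z * Z') = f Z * f Z'"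
      unfolding f_def mult_add_distrib_mat[OF PQ(1) Z] mult_minus_distrib_mat[OF PQ(1) Z]
      by (fact add_mult_distrib_mat[OF PZ PQ(2)] minus_mult_distrib_mat[OF PZ PQ(2)]
          conj_mult[OF PQ(1,2,4) Z, symmetric])+
  qed
  have f_mult_diag: "f (Z * Z') $$ (i, i) = f Z $$ (i, i) * f Z' $$ (i, i)"
    if "Z \<in> A" "Z' \<in> A" "i < n" for Z Z' i
    using upper_triangular_mult_entry[OF f[OF that(1)] f[OF that(2)] order.refl that(3)] that
    by (simp add: f_mult)
  show "nilpotent_mat n (X + Y)" if "nilpotent_mat n X" "nilpotent_mat n Y"
    using that X Y f(1)[OF X] f(1)[OF Y] by (simp add: nil f_add)
  show "nilpotent_mat n (X * Y)" if "nilpotent_mat n X \<or> nilpotent_mat n Y"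
    using that X Y by (auto simp: nil f_mult_diag)
  define C where "C = commutator X Y"
  have C: "C \<in> A"
    using X Y by (simp add: C_def commutator_def)
  have C_diag: "f C $$ (i, i) = f X $$ (i, i) * f Y $$ (i, i) - f Y $$ (i, i) * f X $$ (i, i)" if "i < n" for i
    using X Y that f[of "Y * X"] by (simp add: C_def commutator_def f_minus f_mult_diag)
  have "qTr (C ^\<^sub>m 2) = qTr (f (C * C))"
    using C qTr_conj[OF PQ(1,2,4) carr[of "C * C"]] by (simp add: f_def numeral_2_eq_2)
  also have "\<dots> = 2 * (\<Sum>i<n. qRe (f C $$ (i, i) * f C $$ (i, i)))"
    using f(1)[of "C * C"] C by (simp add: qTr_eq f_mult_diag)
  also have "\<dots> \<le> 0"
    using sum_nonpos[of "{..<n}" "\<lambda>i. qRe (f C $$ (i, i) * f C $$ (i, i))"]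
    by (simp add: C_diag qRe_commutator_square)
  finally show "qTr (commutator X Y ^\<^sub>m 2) \<le> 0"
    by (simp add: C_def)
qed

theorem theorem5p7:
  fixes n :: nat and \<A> :: "quat mat set"
  assumes "unital_real_subalgebra n \<A>"
  shows "(triangularizable n \<A> \<longleftrightarrow>
            (\<forall>A\<in>\<A>. \<forall>B\<in>\<A>. nilpotent_mat n A \<and> nilpotent_mat n B \<longrightarrow> nilpotent_mat n (A + B))) \<and>
         (triangularizable n \<A> \<longleftrightarrow>
            (\<forall>A\<in>\<A>. \<forall>B\<in>\<A>. nilpotent_mat n A \<or> nilpotent_mat n B \<longrightarrow> nilpotent_mat n (A * B))) \<and>
         (triangularizable n \<A> \<longleftrightarrow>
            (\<forall>A\<in>\<A>. \<forall>B\<in>\<A>. qTr (commutator A B ^\<^sub>m 2) \<le> 0))"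
proof -
  interpret real_mat_algebra n \<A>
    by unfold_locales (rule assms)
  note tri = no_nilpotent_pair_imp_triangularizable[OF assms]
  show ?thesis
  proof (intro conjI iffI ballI impI)
    assume "\<forall>A\<in>\<A>. \<forall>B\<in>\<A>. nilpotent_mat n A \<and> nilpotent_mat n B \<longrightarrow> nilpotent_mat n (A + B)"
    then show "triangularizable n \<A>"
      by (intro tri sum_closed_imp_no_nilpotent_pair) blast
  next
    assume "\<forall>A\<in>\<A>. \<forall>B\<in>\<A>. nilpotent_mat n A \<or> nilpotent_mat n B \<longrightarrow> nilpotent_mat n (A * B)"
    then show "triangularizable n \<A>"
      by (intro tri product_closed_imp_no_nilpotent_pair) blast
  next
    assume "\<forall>A\<in>\<A>. \<forall>B\<in>\<A>. qTr (commutator A B ^\<^sub>m 2) \<le> 0"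
    then show "triangularizable n \<A>"
      by (intro tri trace_commutator_imp_no_nilpotent_pair) blast
  qed (use triangularizable_imp[OF assms] in blast)+
qed

end
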